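(* Let $KG$ be the group algebra of a group $G$ over a field $K$ of positive characteristic, such that the torsion part satisfies $t(G)\neq\{1\}$. Then the group of units $U(KG)$ is hyperbolic if and only if $K$ is a finite field and $G$ is a finite group.
   Context: $t(G)$ denotes the set of torsion elements (elements of finite order) of $G$, called the torsion part of $G$. Hyperbolic groups (Gromov): in a metric space $(X,\rho)$ the Gromov product of $b,c\in X$ with respect to $a\in X$ is $\langle b,c\rangle_a=\frac12(\rho(b,a)+\rho(c,a)-\rho(b,c))$. The space is $\delta$-hyperbolic ($\delta\ge 0$) if $\langle a,b\rangle_d\ge\min\{\langle a,c\rangle_d,\langle b,c\rangle_d\}-\delta$ for all $a,b,c,d\in X$. For a group $\Gamma$ with a finite generating set $S$, the Cayley graph is the metric graph with vertex set $\Gamma$ and an edge labeled $s$ joining $g$ to $gs$ for $g\in\Gamma$, $s\in S$. A group $\Gamma$ is hyperbolic if it is finitely generated and its Cayley graph with respect to a finite generating set is a $\delta$-hyperbolic metric space for some $\delta\ge0$ (this does not depend on the choice of the finite generating set). *)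

theory Defs
  imports "HOL-Analysis.Abstract_Metric_Spaces" "HOL-Algebra.Algebra"
begin

section \<open>Group algebras\<close>

definition supp :: "('k, 'm) ring_scheme \<Rightarrow> ('g, 'n) monoid_scheme \<Rightarrow> ('g \<Rightarrow> 'k) \<Rightarrow> 'g set" where
  "supp K G f = {g \<in> carrier G. f g \<noteq> \<zero>\<^bsub>K\<^esub>}"

text \<open>
  An element \<open>\<Sum>\<^sub>g a\<^sub>g g\<close> is the coefficient function \<open>g \<mapsto> a\<^sub>g\<close>, of finite support and
  (as usual for \<open>\<rightarrow>\<^sub>E\<close>) \<^const>\<open>undefined\<close> outside \<open>carrier G\<close>. The coefficient of \<open>x\<close> in
  \<open>(\<Sum>\<^sub>y a\<^sub>y y) (\<Sum>\<^sub>z b\<^sub>z z)\<close> is \<open>\<Sum>\<^bsub>yz = x\<^esub> a\<^sub>y b\<^sub>z\<close>; here \<open>z = y\<^sup>-\<^sup>1 x\<close>.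
\<close>

definition group_algebra ::
    "('k, 'm) ring_scheme \<Rightarrow> ('g, 'n) monoid_scheme \<Rightarrow> ('k, 'g \<Rightarrow> 'k) module" where
  "group_algebra K G =
    \<lparr> carrier = {f \<in> carrier G \<rightarrow>\<^sub>E carrier K. finite (supp K G f)},
      monoid.mult = (\<lambda>f h. \<lambda>x\<in>carrier G.
        \<Oplus>\<^bsub>K\<^esub>y\<in>supp K G f. f y \<otimes>\<^bsub>K\<^esub> h (inv\<^bsub>G\<^esub> y \<otimes>\<^bsub>G\<^esub> x)),
      one = (\<lambda>x\<in>carrier G. if x = \<one>\<^bsub>G\<^esub> then \<one>\<^bsub>K\<^esub> else \<zero>\<^bsub>K\<^esub>),
      ring.zero = (\<lambda>x\<in>carrier G. \<zero>\<^bsub>K\<^esub>),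
      ring.add = (\<lambda>f h. \<lambda>x\<in>carrier G. f x \<oplus>\<^bsub>K\<^esub> h x),
      module.smult = (\<lambda>a f. \<lambda>x\<in>carrier G. a \<otimes>\<^bsub>K\<^esub> f x) \<rparr>"

context
  fixes K (structure) and G (structure)
  assumes K: "field K" and G: "group G"
begin

interpretation K: field K by (rule K)
interpretation G: group G by (rule G)

lemma group_algebra_carrier_D:
  assumes "f \<in> carrier (group_algebra K G)"
  shows "x \<in> carrier G \<Longrightarrow> f x \<in> carrier K" "finite (supp K G f)" "f \<in> extensional (carrier G)"
  using assms by (auto simp: group_algebra_def PiE_def)

lemma group_algebra_carrier_I:
  assumes "\<And>x. x \<in> carrier G \<Longrightarrow> f x \<in> carrier K" "f \<in> extensional (carrier G)"
    "finite A" "\<And>x. \<lbrakk>x \<in> carrier G; x \<notin> A\<rbrakk> \<Longrightarrow> f x = \<zero>\<^bsub>K\<^esub>"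
  shows "f \<in> carrier (group_algebra K G)"
proof -
  have "supp K G f \<subseteq> A"
    using assms(4) by (auto simp: supp_def)
  then have "finite (supp K G f)"
    using assms(3) finite_subset by blast
  then show ?thesis
    using assms(1,2) by (auto simp: group_algebra_def PiE_def)
qed

lemma group_algebra_eqI:
  assumes "f \<in> extensional (carrier G)" "h \<in> extensional (carrier G)"
    "\<And>x. x \<in> carrier G \<Longrightarrow> f x = h x"
  shows "f = h"
  using assms by (rule extensionalityI)

lemma group_algebra_mult_eq:
  assumes f: "f \<in> carrier (group_algebra K G)" and h: "h \<in> carrier (group_algebra K G)"
    and A: "finite A" "A \<subseteq> carrier G" "supp K G f \<subseteq> A" and x: "x \<in> carrier G"
  shows "(f \<otimes>\<^bsub>group_algebra K G\<^esub> h) x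
    = (\<Oplus>\<^bsub>K\<^esub>y\<in>A. f y \<otimes>\<^bsub>K\<^esub> h (inv\<^bsub>G\<^esub> y \<otimes>\<^bsub>G\<^esub> x))"
proof -
  note [simp] = group_algebra_carrier_D(1)[OF f] group_algebra_carrier_D(1)[OF h]
  have "(\<Oplus>\<^bsub>K\<^esub>y\<in>supp K G f. f y \<otimes>\<^bsub>K\<^esub> h (inv\<^bsub>G\<^esub> y \<otimes>\<^bsub>G\<^esub> x))
    = (\<Oplus>\<^bsub>K\<^esub>y\<in>A. f y \<otimes>\<^bsub>K\<^esub> h (inv\<^bsub>G\<^esub> y \<otimes>\<^bsub>G\<^esub> x))"
  proof (rule K.add.finprod_mono_neutral_cong_left)
    fix i assume i: "i \<in> A - supp K G f"
    then have "i \<in> carrier G" "f i = \<zero>\<^bsub>K\<^esub>"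
      using A by (auto simp: supp_def)
    then show "f i \<otimes>\<^bsub>K\<^esub> h (inv\<^bsub>G\<^esub> i \<otimes>\<^bsub>G\<^esub> x) = \<zero>\<^bsub>K\<^esub>"
      using x by simp
  qed (use A x in auto)
  then show ?thesis
    using x by (simp add: group_algebra_def)
qed

lemma group_algebra_add_eq:
  "x \<in> carrier G \<Longrightarrow> (f \<oplus>\<^bsub>group_algebra K G\<^esub> h) x = f x \<oplus>\<^bsub>K\<^esub> h x"
  by (simp add: group_algebra_def)

lemma group_algebra_extensional [simp]:
  "f \<oplus>\<^bsub>group_algebra K G\<^esub> h \<in> extensional (carrier G)"
  "f \<otimes>\<^bsub>group_algebra K G\<^esub> h \<in> extensional (carrier G)"
  "\<one>\<^bsub>group_algebra K G\<^esub> \<in> extensional (carrier G)"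
  "\<zero>\<^bsub>group_algebra K G\<^esub> \<in> extensional (carrier G)"
  "a \<odot>\<^bsub>group_algebra K G\<^esub> f \<in> extensional (carrier G)"
  by (auto simp: group_algebra_def)

lemma group_algebra_mult_eq_0:
  assumes f: "f \<in> carrier (group_algebra K G)" and h: "h \<in> carrier (group_algebra K G)"
    and x: "x \<in> carrier G" "x \<notin> (\<lambda>(y, z). y \<otimes>\<^bsub>G\<^esub> z) ` (supp K G f \<times> supp K G h)"
  shows "(f \<otimes>\<^bsub>group_algebra K G\<^esub> h) x = \<zero>\<^bsub>K\<^esub>"
proof -
  have "f y \<otimes>\<^bsub>K\<^esub> h (inv\<^bsub>G\<^esub> y \<otimes>\<^bsub>G\<^esub> x) = \<zero>\<^bsub>K\<^esub>" if y: "y \<in> supp K G f" for y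
  proof -
    have yG: "y \<in> carrier G"
      using y by (simp add: supp_def)
    have "x = y \<otimes>\<^bsub>G\<^esub> (inv\<^bsub>G\<^esub> y \<otimes>\<^bsub>G\<^esub> x)"
      using yG x by (simp add: G.m_assoc[symmetric])
    then have "inv\<^bsub>G\<^esub> y \<otimes>\<^bsub>G\<^esub> x \<notin> supp K G h"
      using x(2) y by (metis (no_types, lifting) SigmaI image_eqI case_prod_conv)
    then have "h (inv\<^bsub>G\<^esub> y \<otimes>\<^bsub>G\<^esub> x) = \<zero>\<^bsub>K\<^esub>"
      using yG x by (simp add: supp_def)
    then show ?thesis
      using group_algebra_carrier_D(1)[OF f] yG by simp
  qed
  then show ?thesis
    using x(1) by (simp add: group_algebra_def K.add.finprod_one_eqI)
qed

lemma group_algebra_mult_closed: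
  assumes f: "f \<in> carrier (group_algebra K G)" and h: "h \<in> carrier (group_algebra K G)"
  shows "f \<otimes>\<^bsub>group_algebra K G\<^esub> h \<in> carrier (group_algebra K G)"
proof (rule group_algebra_carrier_I)
  show "finite ((\<lambda>(y, z). y \<otimes>\<^bsub>G\<^esub> z) ` (supp K G f \<times> supp K G h))"
    using group_algebra_carrier_D(2)[OF f] group_algebra_carrier_D(2)[OF h] by auto
  fix x assume x: "x \<in> carrier G"
  have "f y \<otimes>\<^bsub>K\<^esub> h (inv\<^bsub>G\<^esub> y \<otimes>\<^bsub>G\<^esub> x) \<in> carrier K" if "y \<in> carrier G" for y
    using that x group_algebra_carrier_D(1)[OF f] group_algebra_carrier_D(1)[OF h] by simp
  then show "(f \<otimes>\<^bsub>group_algebra K G\<^esub> h) x \<in> carrier K"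
    using x by (auto simp: group_algebra_def supp_def intro!: K.finsum_closed)
qed (use group_algebra_mult_eq_0[OF f h] in auto)

lemma group_algebra_add_closed:
  assumes f: "f \<in> carrier (group_algebra K G)" and h: "h \<in> carrier (group_algebra K G)"
  shows "f \<oplus>\<^bsub>group_algebra K G\<^esub> h \<in> carrier (group_algebra K G)"
proof (rule group_algebra_carrier_I)
  show "finite (supp K G f \<union> supp K G h)"
    using group_algebra_carrier_D(2)[OF f] group_algebra_carrier_D(2)[OF h] by auto
qed (use group_algebra_carrier_D[OF f] group_algebra_carrier_D[OF h] in
     \<open>auto simp: group_algebra_add_eq supp_def\<close>)

lemma group_algebra_one_closed: "\<one>\<^bsub>group_algebra K G\<^esub> \<in> carrier (group_algebra K G)"
  by (rule group_algebra_carrier_I[where A = "{\<one>\<^bsub>G\<^esub>}"]) (auto simp: group_algebra_def)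

lemma group_algebra_zero_closed: "\<zero>\<^bsub>group_algebra K G\<^esub> \<in> carrier (group_algebra K G)"
  by (rule group_algebra_carrier_I[where A = "{}"]) (auto simp: group_algebra_def)

lemma finsum_swap:
  assumes "finite A" "finite B" "\<And>a b. \<lbrakk>a \<in> A; b \<in> B\<rbrakk> \<Longrightarrow> f a b \<in> carrier K"
  shows "(\<Oplus>\<^bsub>K\<^esub>a\<in>A. \<Oplus>\<^bsub>K\<^esub>b\<in>B. f a b) = (\<Oplus>\<^bsub>K\<^esub>b\<in>B. \<Oplus>\<^bsub>K\<^esub>a\<in>A. f a b)"
  using assms(1,3)
proof (induction A rule: finite_induct)
  case empty
  then show ?case by simp
next
  case (insert x F)
  have 1: "(\<Oplus>\<^bsub>K\<^esub>b\<in>B. f a b) \<in> carrier K" if "a \<in> insert x F" for a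
    using insert.prems that by (auto intro!: K.finsum_closed)
  have 2: "(\<Oplus>\<^bsub>K\<^esub>a\<in>F. f a b) \<in> carrier K" if "b \<in> B" for b
    using insert.prems that by (auto intro!: K.finsum_closed)
  have "(\<Oplus>\<^bsub>K\<^esub>a\<in>insert x F. \<Oplus>\<^bsub>K\<^esub>b\<in>B. f a b)
      = (\<Oplus>\<^bsub>K\<^esub>b\<in>B. f x b) \<oplus>\<^bsub>K\<^esub> (\<Oplus>\<^bsub>K\<^esub>b\<in>B. \<Oplus>\<^bsub>K\<^esub>a\<in>F. f a b)"
    using insert 1 by (simp add: Pi_def)
  also have "\<dots> = (\<Oplus>\<^bsub>K\<^esub>b\<in>B. f x b \<oplus>\<^bsub>K\<^esub> (\<Oplus>\<^bsub>K\<^esub>a\<in>F. f a b))"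
    using insert.prems 2 by (subst K.finsum_addf) auto
  also have "\<dots> = (\<Oplus>\<^bsub>K\<^esub>b\<in>B. \<Oplus>\<^bsub>K\<^esub>a\<in>insert x F. f a b)"
    using insert 2 by (intro K.add.finprod_cong') (auto simp: Pi_def)
  finally show ?case .
qed

lemma group_algebra_mult_assoc:
  assumes f: "f \<in> carrier (group_algebra K G)" and g: "g \<in> carrier (group_algebra K G)"
    and h: "h \<in> carrier (group_algebra K G)"
  shows "(f \<otimes>\<^bsub>group_algebra K G\<^esub> g) \<otimes>\<^bsub>group_algebra K G\<^esub> h
    = f \<otimes>\<^bsub>group_algebra K G\<^esub> (g \<otimes>\<^bsub>group_algebra K G\<^esub> h)"
proof (rule group_algebra_eqI)
  fix x assume x: "x \<in> carrier G"
  note [simp] = group_algebra_carrier_D(1)[OF f] group_algebra_carrier_D(1)[OF g]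
    group_algebra_carrier_D(1)[OF h]
  define A B W where "A = supp K G f" and "B = supp K G g"
    and "W = (\<lambda>(y, z). y \<otimes>\<^bsub>G\<^esub> z) ` (A \<times> B)"
  have fin: "finite A" "finite B" "finite W"
    using group_algebra_carrier_D(2)[OF f] group_algebra_carrier_D(2)[OF g]
    by (auto simp: A_def B_def W_def)
  have sub: "A \<subseteq> carrier G" "B \<subseteq> carrier G" "W \<subseteq> carrier G"
    by (auto simp: A_def B_def W_def supp_def)
  have Ac: "\<And>a. a \<in> A \<Longrightarrow> a \<in> carrier G" and Bc: "\<And>a. a \<in> B \<Longrightarrow> a \<in> carrier G"
    and Wc: "\<And>a. a \<in> W \<Longrightarrow> a \<in> carrier G"
    using sub by auto
  have supW: "supp K G (f \<otimes>\<^bsub>group_algebra K G\<^esub> g) \<subseteq> W"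
    using group_algebra_mult_eq_0[OF f g] by (auto simp: W_def A_def B_def supp_def)
  have inner: "(\<Oplus>\<^bsub>K\<^esub>w\<in>W. g (inv\<^bsub>G\<^esub> y \<otimes>\<^bsub>G\<^esub> w) \<otimes>\<^bsub>K\<^esub> h (inv\<^bsub>G\<^esub> w \<otimes>\<^bsub>G\<^esub> x))
      = (g \<otimes>\<^bsub>group_algebra K G\<^esub> h) (inv\<^bsub>G\<^esub> y \<otimes>\<^bsub>G\<^esub> x)" if y: "y \<in> A" for y
  proof -
    have yG: "y \<in> carrier G" using y Ac by simp
    define C where "C = (\<lambda>w. inv\<^bsub>G\<^esub> y \<otimes>\<^bsub>G\<^esub> w) ` W"
    have C: "finite C" "C \<subseteq> carrier G"
      using fin yG Wc by (auto simp: C_def)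
    have "supp K G g \<subseteq> C"
    proof
      fix b assume b: "b \<in> supp K G g"
      then have bG: "b \<in> carrier G" by (simp add: supp_def)
      have "y \<otimes>\<^bsub>G\<^esub> b \<in> W"
        using y b by (force simp: W_def B_def)
      moreover have "b = inv\<^bsub>G\<^esub> y \<otimes>\<^bsub>G\<^esub> (y \<otimes>\<^bsub>G\<^esub> b)"
        using yG bG by (simp add: G.m_assoc[symmetric])
      ultimately show "b \<in> C" by (auto simp: C_def)
    qed
    then have "(g \<otimes>\<^bsub>group_algebra K G\<^esub> h) (inv\<^bsub>G\<^esub> y \<otimes>\<^bsub>G\<^esub> x)
      = (\<Oplus>\<^bsub>K\<^esub>z\<in>C. g z \<otimes>\<^bsub>K\<^esub> h (inv\<^bsub>G\<^esub> z \<otimes>\<^bsub>G\<^esub> (inv\<^bsub>G\<^esub> y \<otimes>\<^bsub>G\<^esub> x)))"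
      using C x yG by (intro group_algebra_mult_eq[OF g h]) auto
    also have "\<dots> = (\<Oplus>\<^bsub>K\<^esub>w\<in>W. g (inv\<^bsub>G\<^esub> y \<otimes>\<^bsub>G\<^esub> w) \<otimes>\<^bsub>K\<^esub>
        h (inv\<^bsub>G\<^esub> (inv\<^bsub>G\<^esub> y \<otimes>\<^bsub>G\<^esub> w) \<otimes>\<^bsub>G\<^esub> (inv\<^bsub>G\<^esub> y \<otimes>\<^bsub>G\<^esub> x)))"
      unfolding C_def using yG Wc x
      by (intro K.add.finprod_reindex) (auto simp: inj_on_def)
    also have "\<dots> = (\<Oplus>\<^bsub>K\<^esub>w\<in>W. g (inv\<^bsub>G\<^esub> y \<otimes>\<^bsub>G\<^esub> w) \<otimes>\<^bsub>K\<^esub> h (inv\<^bsub>G\<^esub> w \<otimes>\<^bsub>G\<^esub> x))"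
    proof (rule K.add.finprod_cong')
      fix w assume w: "w \<in> W"
      have wG: "w \<in> carrier G" using w Wc by simp
      have "inv\<^bsub>G\<^esub> (inv\<^bsub>G\<^esub> y \<otimes>\<^bsub>G\<^esub> w) \<otimes>\<^bsub>G\<^esub> (inv\<^bsub>G\<^esub> y \<otimes>\<^bsub>G\<^esub> x)
        = inv\<^bsub>G\<^esub> w \<otimes>\<^bsub>G\<^esub> (y \<otimes>\<^bsub>G\<^esub> (inv\<^bsub>G\<^esub> y \<otimes>\<^bsub>G\<^esub> x))"
        using wG yG x by (simp add: G.inv_mult_group G.m_assoc)
      also have "y \<otimes>\<^bsub>G\<^esub> (inv\<^bsub>G\<^esub> y \<otimes>\<^bsub>G\<^esub> x) = x"
        using yG x by (simp add: G.m_assoc[symmetric])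
      finally show "g (inv\<^bsub>G\<^esub> y \<otimes>\<^bsub>G\<^esub> w) \<otimes>\<^bsub>K\<^esub>
          h (inv\<^bsub>G\<^esub> (inv\<^bsub>G\<^esub> y \<otimes>\<^bsub>G\<^esub> w) \<otimes>\<^bsub>G\<^esub> (inv\<^bsub>G\<^esub> y \<otimes>\<^bsub>G\<^esub> x))
        = g (inv\<^bsub>G\<^esub> y \<otimes>\<^bsub>G\<^esub> w) \<otimes>\<^bsub>K\<^esub> h (inv\<^bsub>G\<^esub> w \<otimes>\<^bsub>G\<^esub> x)" by simp
    qed (use yG Wc x in auto)
    finally show ?thesis ..
  qed
  have "((f \<otimes>\<^bsub>group_algebra K G\<^esub> g) \<otimes>\<^bsub>group_algebra K G\<^esub> h) x
      = (\<Oplus>\<^bsub>K\<^esub>w\<in>W. (f \<otimes>\<^bsub>group_algebra K G\<^esub> g) w \<otimes>\<^bsub>K\<^esub> h (inv\<^bsub>G\<^esub> w \<otimes>\<^bsub>G\<^esub> x))"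
    using fin sub supW x by (intro group_algebra_mult_eq group_algebra_mult_closed f g h) auto
  also have "\<dots> = (\<Oplus>\<^bsub>K\<^esub>w\<in>W. \<Oplus>\<^bsub>K\<^esub>y\<in>A.
      f y \<otimes>\<^bsub>K\<^esub> (g (inv\<^bsub>G\<^esub> y \<otimes>\<^bsub>G\<^esub> w) \<otimes>\<^bsub>K\<^esub> h (inv\<^bsub>G\<^esub> w \<otimes>\<^bsub>G\<^esub> x)))"
  proof (rule K.add.finprod_cong')
    fix w assume w: "w \<in> W"
    have wG: "w \<in> carrier G" using w Wc by simp
    have "(f \<otimes>\<^bsub>group_algebra K G\<^esub> g) w = (\<Oplus>\<^bsub>K\<^esub>y\<in>A. f y \<otimes>\<^bsub>K\<^esub> g (inv\<^bsub>G\<^esub> y \<otimes>\<^bsub>G\<^esub> w))"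
      using wG fin sub by (intro group_algebra_mult_eq f g) (auto simp: A_def)
    then have "(f \<otimes>\<^bsub>group_algebra K G\<^esub> g) w \<otimes>\<^bsub>K\<^esub> h (inv\<^bsub>G\<^esub> w \<otimes>\<^bsub>G\<^esub> x)
      = (\<Oplus>\<^bsub>K\<^esub>y\<in>A. f y \<otimes>\<^bsub>K\<^esub> g (inv\<^bsub>G\<^esub> y \<otimes>\<^bsub>G\<^esub> w) \<otimes>\<^bsub>K\<^esub> h (inv\<^bsub>G\<^esub> w \<otimes>\<^bsub>G\<^esub> x))"
      using wG fin Ac x by (simp add: K.finsum_ldistr Pi_def)
    also have "\<dots> = (\<Oplus>\<^bsub>K\<^esub>y\<in>A.
      f y \<otimes>\<^bsub>K\<^esub> (g (inv\<^bsub>G\<^esub> y \<otimes>\<^bsub>G\<^esub> w) \<otimes>\<^bsub>K\<^esub> h (inv\<^bsub>G\<^esub> w \<otimes>\<^bsub>G\<^esub> x)))"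
      using wG Ac x by (intro K.add.finprod_cong') (auto simp: K.m_assoc)
    finally show "(f \<otimes>\<^bsub>group_algebra K G\<^esub> g) w \<otimes>\<^bsub>K\<^esub> h (inv\<^bsub>G\<^esub> w \<otimes>\<^bsub>G\<^esub> x)
      = (\<Oplus>\<^bsub>K\<^esub>y\<in>A.
      f y \<otimes>\<^bsub>K\<^esub> (g (inv\<^bsub>G\<^esub> y \<otimes>\<^bsub>G\<^esub> w) \<otimes>\<^bsub>K\<^esub> h (inv\<^bsub>G\<^esub> w \<otimes>\<^bsub>G\<^esub> x)))" .
  qed (use Ac Wc x in \<open>auto intro!: K.finsum_closed\<close>)
  also have "\<dots> = (\<Oplus>\<^bsub>K\<^esub>y\<in>A. \<Oplus>\<^bsub>K\<^esub>w\<in>W.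
      f y \<otimes>\<^bsub>K\<^esub> (g (inv\<^bsub>G\<^esub> y \<otimes>\<^bsub>G\<^esub> w) \<otimes>\<^bsub>K\<^esub> h (inv\<^bsub>G\<^esub> w \<otimes>\<^bsub>G\<^esub> x)))"
    using fin Ac Wc x by (intro finsum_swap) auto
  also have "\<dots> = (\<Oplus>\<^bsub>K\<^esub>y\<in>A. f y \<otimes>\<^bsub>K\<^esub> (g \<otimes>\<^bsub>group_algebra K G\<^esub> h) (inv\<^bsub>G\<^esub> y \<otimes>\<^bsub>G\<^esub> x))"
  proof (rule K.add.finprod_cong')
    fix y assume y: "y \<in> A"
    show "(\<Oplus>\<^bsub>K\<^esub>w\<in>W. f y \<otimes>\<^bsub>K\<^esub> (g (inv\<^bsub>G\<^esub> y \<otimes>\<^bsub>G\<^esub> w) \<otimes>\<^bsub>K\<^esub> h (inv\<^bsub>G\<^esub> w \<otimes>\<^bsub>G\<^esub> x)))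
      = f y \<otimes>\<^bsub>K\<^esub> (g \<otimes>\<^bsub>group_algebra K G\<^esub> h) (inv\<^bsub>G\<^esub> y \<otimes>\<^bsub>G\<^esub> x)"
      unfolding inner[OF y, symmetric] using y Ac Wc x fin
      by (intro K.finsum_rdistr[symmetric]) auto
  qed (use Ac x group_algebra_carrier_D(1)[OF group_algebra_mult_closed[OF g h]] in auto)
  also have "\<dots> = (f \<otimes>\<^bsub>group_algebra K G\<^esub> (g \<otimes>\<^bsub>group_algebra K G\<^esub> h)) x"
    using fin sub x
    by (intro group_algebra_mult_eq[symmetric] group_algebra_mult_closed f g h) (auto simp: A_def)
  finally show "((f \<otimes>\<^bsub>group_algebra K G\<^esub> g) \<otimes>\<^bsub>group_algebra K G\<^esub> h) x
      = (f \<otimes>\<^bsub>group_algebra K G\<^esub> (g \<otimes>\<^bsub>group_algebra K G\<^esub> h)) x" .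
qed auto

lemma group_algebra_l_one:
  assumes f: "f \<in> carrier (group_algebra K G)"
  shows "\<one>\<^bsub>group_algebra K G\<^esub> \<otimes>\<^bsub>group_algebra K G\<^esub> f = f"
proof (rule group_algebra_eqI)
  fix x assume x: "x \<in> carrier G"
  have "(\<one>\<^bsub>group_algebra K G\<^esub> \<otimes>\<^bsub>group_algebra K G\<^esub> f) x
    = (\<Oplus>\<^bsub>K\<^esub>y\<in>{\<one>\<^bsub>G\<^esub>}. \<one>\<^bsub>group_algebra K G\<^esub> y \<otimes>\<^bsub>K\<^esub> f (inv\<^bsub>G\<^esub> y \<otimes>\<^bsub>G\<^esub> x))"
    using x by (intro group_algebra_mult_eq group_algebra_one_closed f)
      (auto simp: supp_def group_algebra_def)
  also have "\<dots> = f x"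
    using x group_algebra_carrier_D(1)[OF f x] by (simp add: group_algebra_def)
  finally show "(\<one>\<^bsub>group_algebra K G\<^esub> \<otimes>\<^bsub>group_algebra K G\<^esub> f) x = f x" .
qed (use group_algebra_carrier_D(3)[OF f] in auto)

lemma group_algebra_r_one:
  assumes f: "f \<in> carrier (group_algebra K G)"
  shows "f \<otimes>\<^bsub>group_algebra K G\<^esub> \<one>\<^bsub>group_algebra K G\<^esub> = f"
proof (rule group_algebra_eqI)
  fix x assume x: "x \<in> carrier G"
  have fin: "finite (supp K G f)" by (rule group_algebra_carrier_D(2)[OF f])
  have "(f \<otimes>\<^bsub>group_algebra K G\<^esub> \<one>\<^bsub>group_algebra K G\<^esub>) x
    = (\<Oplus>\<^bsub>K\<^esub>y\<in>insert x (supp K G f). f y \<otimes>\<^bsub>K\<^esub> \<one>\<^bsub>group_algebra K G\<^esub> (inv\<^bsub>G\<^esub> y \<otimes>\<^bsub>G\<^esub> x))"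
    using x fin by (intro group_algebra_mult_eq group_algebra_one_closed f) (auto simp: supp_def)
  also have "\<dots> = (\<Oplus>\<^bsub>K\<^esub>y\<in>insert x (supp K G f). if x = y then f y else \<zero>\<^bsub>K\<^esub>)"
  proof (rule K.add.finprod_cong')
    fix y assume "y \<in> insert x (supp K G f)"
    then have y: "y \<in> carrier G" using x by (auto simp: supp_def)
    have "inv\<^bsub>G\<^esub> y \<otimes>\<^bsub>G\<^esub> x = \<one>\<^bsub>G\<^esub> \<longleftrightarrow> x = y"
      using x y by (metis G.inv_closed G.inv_equality G.inv_inv G.l_inv)
    then show "f y \<otimes>\<^bsub>K\<^esub> \<one>\<^bsub>group_algebra K G\<^esub> (inv\<^bsub>G\<^esub> y \<otimes>\<^bsub>G\<^esub> x)
        = (if x = y then f y else \<zero>\<^bsub>K\<^esub>)"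
      using x y group_algebra_carrier_D(1)[OF f y] by (simp add: group_algebra_def)
  qed (use x group_algebra_carrier_D(1)[OF f] in \<open>auto simp: supp_def\<close>)
  also have "\<dots> = f x"
    using x fin group_algebra_carrier_D(1)[OF f]
    by (intro K.finsum_singleton) (auto simp: supp_def)
  finally show "(f \<otimes>\<^bsub>group_algebra K G\<^esub> \<one>\<^bsub>group_algebra K G\<^esub>) x = f x" .
qed (use group_algebra_carrier_D(3)[OF f] in auto)

lemma group_algebra_l_distr:
  assumes f: "f \<in> carrier (group_algebra K G)" and g: "g \<in> carrier (group_algebra K G)"
    and h: "h \<in> carrier (group_algebra K G)"
  shows "(f \<oplus>\<^bsub>group_algebra K G\<^esub> g) \<otimes>\<^bsub>group_algebra K G\<^esub> h
    = f \<otimes>\<^bsub>group_algebra K G\<^esub> h \<oplus>\<^bsub>group_algebra K G\<^esub> g \<otimes>\<^bsub>group_algebra K G\<^esub> h"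
proof (rule group_algebra_eqI)
  fix x assume x: "x \<in> carrier G"
  note [simp] = group_algebra_carrier_D(1)[OF f] group_algebra_carrier_D(1)[OF g]
    group_algebra_carrier_D(1)[OF h]
  define A where "A = supp K G f \<union> supp K G g"
  have A: "finite A" "A \<subseteq> carrier G" "supp K G f \<subseteq> A" "supp K G g \<subseteq> A"
    using group_algebra_carrier_D(2)[OF f] group_algebra_carrier_D(2)[OF g]
    by (auto simp: A_def supp_def)
  then have Ac: "\<And>a. a \<in> A \<Longrightarrow> a \<in> carrier G" by auto
  have A': "supp K G (f \<oplus>\<^bsub>group_algebra K G\<^esub> g) \<subseteq> A"
    by (auto simp: A_def supp_def group_algebra_add_eq)
  have "((f \<oplus>\<^bsub>group_algebra K G\<^esub> g) \<otimes>\<^bsub>group_algebra K G\<^esub> h) x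
    = (\<Oplus>\<^bsub>K\<^esub>y\<in>A. (f \<oplus>\<^bsub>group_algebra K G\<^esub> g) y \<otimes>\<^bsub>K\<^esub> h (inv\<^bsub>G\<^esub> y \<otimes>\<^bsub>G\<^esub> x))"
    by (intro group_algebra_mult_eq group_algebra_add_closed f g h A A' x)
  also have "\<dots> = (\<Oplus>\<^bsub>K\<^esub>y\<in>A. f y \<otimes>\<^bsub>K\<^esub> h (inv\<^bsub>G\<^esub> y \<otimes>\<^bsub>G\<^esub> x) \<oplus>\<^bsub>K\<^esub> g y \<otimes>\<^bsub>K\<^esub> h (inv\<^bsub>G\<^esub> y \<otimes>\<^bsub>G\<^esub> x))"
    using Ac x by (intro K.add.finprod_cong') (auto simp: group_algebra_add_eq K.l_distr)
  also have "\<dots> = (f \<otimes>\<^bsub>group_algebra K G\<^esub> h) x \<oplus>\<^bsub>K\<^esub> (g \<otimes>\<^bsub>group_algebra K G\<^esub> h) x"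
    using Ac x A f g h by (subst K.finsum_addf) (auto simp: group_algebra_mult_eq[where A = A])
  finally show "((f \<oplus>\<^bsub>group_algebra K G\<^esub> g) \<otimes>\<^bsub>group_algebra K G\<^esub> h) x
    = (f \<otimes>\<^bsub>group_algebra K G\<^esub> h \<oplus>\<^bsub>group_algebra K G\<^esub> g \<otimes>\<^bsub>group_algebra K G\<^esub> h) x"
    using x by (simp add: group_algebra_add_eq)
qed auto

lemma group_algebra_r_distr:
  assumes f: "f \<in> carrier (group_algebra K G)" and g: "g \<in> carrier (group_algebra K G)"
    and h: "h \<in> carrier (group_algebra K G)"
  shows "h \<otimes>\<^bsub>group_algebra K G\<^esub> (f \<oplus>\<^bsub>group_algebra K G\<^esub> g)
    = h \<otimes>\<^bsub>group_algebra K G\<^esub> f \<oplus>\<^bsub>group_algebra K G\<^esub> h \<otimes>\<^bsub>group_algebra K G\<^esub> g"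
proof (rule group_algebra_eqI)
  fix x assume x: "x \<in> carrier G"
  note [simp] = group_algebra_carrier_D(1)[OF f] group_algebra_carrier_D(1)[OF g]
    group_algebra_carrier_D(1)[OF h]
  define A where "A = supp K G h"
  have A: "finite A" "A \<subseteq> carrier G" "supp K G h \<subseteq> A"
    using group_algebra_carrier_D(2)[OF h] by (auto simp: A_def supp_def)
  then have Ac: "\<And>a. a \<in> A \<Longrightarrow> a \<in> carrier G" by auto
  have "(h \<otimes>\<^bsub>group_algebra K G\<^esub> (f \<oplus>\<^bsub>group_algebra K G\<^esub> g)) x
    = (\<Oplus>\<^bsub>K\<^esub>y\<in>A. h y \<otimes>\<^bsub>K\<^esub> (f \<oplus>\<^bsub>group_algebra K G\<^esub> g) (inv\<^bsub>G\<^esub> y \<otimes>\<^bsub>G\<^esub> x))"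
    by (intro group_algebra_mult_eq group_algebra_add_closed f g h A x)
  also have "\<dots> = (\<Oplus>\<^bsub>K\<^esub>y\<in>A. h y \<otimes>\<^bsub>K\<^esub> f (inv\<^bsub>G\<^esub> y \<otimes>\<^bsub>G\<^esub> x) \<oplus>\<^bsub>K\<^esub> h y \<otimes>\<^bsub>K\<^esub> g (inv\<^bsub>G\<^esub> y \<otimes>\<^bsub>G\<^esub> x))"
    using Ac x by (intro K.add.finprod_cong') (auto simp: group_algebra_add_eq K.r_distr)
  also have "\<dots> = (h \<otimes>\<^bsub>group_algebra K G\<^esub> f) x \<oplus>\<^bsub>K\<^esub> (h \<otimes>\<^bsub>group_algebra K G\<^esub> g) x"
    using Ac x A f g h by (subst K.finsum_addf) (auto simp: group_algebra_mult_eq[where A = A])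
  finally show "(h \<otimes>\<^bsub>group_algebra K G\<^esub> (f \<oplus>\<^bsub>group_algebra K G\<^esub> g)) x
    = (h \<otimes>\<^bsub>group_algebra K G\<^esub> f \<oplus>\<^bsub>group_algebra K G\<^esub> h \<otimes>\<^bsub>group_algebra K G\<^esub> g) x"
    using x by (simp add: group_algebra_add_eq)
qed auto

lemma group_algebra_minus:
  assumes f: "f \<in> carrier (group_algebra K G)"
  shows "\<exists>g\<in>carrier (group_algebra K G). g \<oplus>\<^bsub>group_algebra K G\<^esub> f = \<zero>\<^bsub>group_algebra K G\<^esub>"
proof
  let ?g = "\<lambda>x\<in>carrier G. \<ominus>\<^bsub>K\<^esub> f x"
  show "?g \<in> carrier (group_algebra K G)"
    using group_algebra_carrier_D[OF f]
    by (intro group_algebra_carrier_I[where A = "supp K G f"]) (auto simp: supp_def)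
  show "?g \<oplus>\<^bsub>group_algebra K G\<^esub> f = \<zero>\<^bsub>group_algebra K G\<^esub>"
    using group_algebra_carrier_D(1)[OF f]
    by (auto simp: group_algebra_def K.l_neg restrict_def)
qed

lemma ring_group_algebra: "ring (group_algebra K G)"
proof (rule ringI)
  show "abelian_group (group_algebra K G)"
  proof (rule abelian_groupI)
    fix f g h
    assume f: "f \<in> carrier (group_algebra K G)" and g: "g \<in> carrier (group_algebra K G)"
    note fg = group_algebra_carrier_D(1)[OF f] group_algebra_carrier_D(1)[OF g]
    show "f \<oplus>\<^bsub>group_algebra K G\<^esub> g = g \<oplus>\<^bsub>group_algebra K G\<^esub> f"
      by (rule group_algebra_eqI) (auto simp: fg group_algebra_add_eq K.a_comm)
    assume h: "h \<in> carrier (group_algebra K G)"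
    show "f \<oplus>\<^bsub>group_algebra K G\<^esub> g \<oplus>\<^bsub>group_algebra K G\<^esub> h
        = f \<oplus>\<^bsub>group_algebra K G\<^esub> (g \<oplus>\<^bsub>group_algebra K G\<^esub> h)"
      using group_algebra_carrier_D(1)[OF h]
      by (intro group_algebra_eqI) (auto simp: fg group_algebra_add_eq K.a_assoc)
  next
    fix f assume f: "f \<in> carrier (group_algebra K G)"
    show "\<zero>\<^bsub>group_algebra K G\<^esub> \<oplus>\<^bsub>group_algebra K G\<^esub> f = f"
      using group_algebra_carrier_D(1,3)[OF f]
      by (intro group_algebra_eqI) (auto simp: group_algebra_def)
  qed (auto intro: group_algebra_add_closed group_algebra_zero_closed group_algebra_minus)
  show "Group.monoid (group_algebra K G)"
    by (rule Group.monoidI)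
      (auto intro: group_algebra_mult_closed group_algebra_one_closed group_algebra_mult_assoc
        group_algebra_l_one group_algebra_r_one)
qed (auto intro: group_algebra_l_distr group_algebra_r_distr)

end


definition ring_characteristic :: "('k, 'm) ring_scheme \<Rightarrow> nat" where
  "ring_characteristic R =
    (if \<exists>n::nat. n > 0 \<and> [n] \<cdot>\<^bsub>R\<^esub> \<one>\<^bsub>R\<^esub> = \<zero>\<^bsub>R\<^esub>
     then LEAST n::nat. n > 0 \<and> [n] \<cdot>\<^bsub>R\<^esub> \<one>\<^bsub>R\<^esub> = \<zero>\<^bsub>R\<^esub> else 0)"

definition torsion_part :: "('g, 'n) monoid_scheme \<Rightarrow> 'g set" where
  "torsion_part G = {g \<in> carrier G. \<exists>n::nat. n > 0 \<and> g [^]\<^bsub>G\<^esub> n = \<one>\<^bsub>G\<^esub>}"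


section \<open>Hyperbolic metric spaces\<close>

definition gromov_product :: "('a \<Rightarrow> 'a \<Rightarrow> real) \<Rightarrow> 'a \<Rightarrow> 'a \<Rightarrow> 'a \<Rightarrow> real" where
  "gromov_product d a b c = (d b a + d c a - d b c) / 2"

context Metric_space
begin

definition delta_hyperbolic :: "real \<Rightarrow> bool" where
  "delta_hyperbolic \<delta> \<longleftrightarrow> \<delta> \<ge> 0 \<and>
    (\<forall>x\<in>M. \<forall>y\<in>M. \<forall>z\<in>M. \<forall>w\<in>M.
      gromov_product d w x y \<ge> min (gromov_product d w x z) (gromov_product d w y z) - \<delta>)"

end


section \<open>The Cayley graph as a metric graph\<close>

text \<open>
  For each \<open>g\<close> and each \<open>s \<in> S\<close> there is an edge of length \<open>1\<close> from \<open>g\<close> to \<open>g s\<close>; its points are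
  \<open>edge_point \<Gamma> g s t\<close> with \<open>0 \<le> t \<le> 1\<close>. Different pairs \<open>(g, s)\<close> give different
  open edges, so there are double edges if \<open>s, s\<^sup>-\<^sup>1 \<in> S\<close>, and loops if \<open>\<one> \<in> S\<close>.
\<close>

datatype 'a cayley_point = Vertex 'a | Interior 'a 'a real

definition edge_point :: "('a, 'm) monoid_scheme \<Rightarrow> 'a \<Rightarrow> 'a \<Rightarrow> real \<Rightarrow> 'a cayley_point" where
  "edge_point \<Gamma> g s t =
    (if t = 0 then Vertex g else if t = 1 then Vertex (g \<otimes>\<^bsub>\<Gamma>\<^esub> s) else Interior g s t)"

definition cayley_graph :: "('a, 'm) monoid_scheme \<Rightarrow> 'a set \<Rightarrow> 'a cayley_point set" where
  "cayley_graph \<Gamma> S = Vertex ` carrier \<Gamma> \<union>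
    {Interior g s t | g s t. g \<in> carrier \<Gamma> \<and> s \<in> S \<and> 0 < t \<and> t < 1}"

text \<open>
  \<open>cayley_path \<Gamma> S p q l\<close>: there is a path of length \<open>l\<close> from \<open>p\<close> to \<open>q\<close> that is a finite
  concatenation of segments, each contained in a single closed edge.
\<close>

inductive cayley_path ::
    "('a, 'm) monoid_scheme \<Rightarrow> 'a set \<Rightarrow> 'a cayley_point \<Rightarrow> 'a cayley_point \<Rightarrow> real \<Rightarrow> bool"
  for \<Gamma> S where
  refl: "p \<in> cayley_graph \<Gamma> S \<Longrightarrow> cayley_path \<Gamma> S p p 0"
| step: "\<lbrakk> cayley_path \<Gamma> S p (edge_point \<Gamma> g s a) l; g \<in> carrier \<Gamma>; s \<in> S;
           a \<in> {0..1}; b \<in> {0..1} \<rbrakk>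
         \<Longrightarrow> cayley_path \<Gamma> S p (edge_point \<Gamma> g s b) (l + \<bar>b - a\<bar>)"

text \<open>
  The path metric. It is set to \<open>0\<close> off the graph because \<^locale>\<open>Metric_space\<close> asks for
  symmetry and nonnegativity on the whole type.
\<close>

definition cayley_dist ::
    "('a, 'm) monoid_scheme \<Rightarrow> 'a set \<Rightarrow> 'a cayley_point \<Rightarrow> 'a cayley_point \<Rightarrow> real" where
  "cayley_dist \<Gamma> S p q =
    (if p \<in> cayley_graph \<Gamma> S \<and> q \<in> cayley_graph \<Gamma> S
     then Inf {l. cayley_path \<Gamma> S p q l} else 0)"

lemma edge_point_in_cayley_graph:
  assumes "group \<Gamma>" "S \<subseteq> carrier \<Gamma>" "g \<in> carrier \<Gamma>" "s \<in> S" "t \<in> {0..1}"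
  shows "edge_point \<Gamma> g s t \<in> cayley_graph \<Gamma> S"
proof -
  have "g \<otimes>\<^bsub>\<Gamma>\<^esub> s \<in> carrier \<Gamma>"
    using assms by (meson group.is_monoid monoid.m_closed subsetD)
  then show ?thesis
    using assms by (auto simp: edge_point_def cayley_graph_def)
qed

lemma cayley_path_in_graph:
  assumes "cayley_path \<Gamma> S p q l" "group \<Gamma>" "S \<subseteq> carrier \<Gamma>"
  shows "p \<in> cayley_graph \<Gamma> S \<and> q \<in> cayley_graph \<Gamma> S \<and> 0 \<le> l"
  using assms by (induction rule: cayley_path.induct) (auto intro: edge_point_in_cayley_graph)

lemma cayley_path_edge:
  assumes "group \<Gamma>" "S \<subseteq> carrier \<Gamma>" "g \<in> carrier \<Gamma>" "s \<in> S" "a \<in> {0..1}" "b \<in> {0..1}"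
  shows "cayley_path \<Gamma> S (edge_point \<Gamma> g s a) (edge_point \<Gamma> g s b) \<bar>b - a\<bar>"
  using cayley_path.step[OF cayley_path.refl[OF edge_point_in_cayley_graph[OF assms(1-5)]]
      assms(3-6)] by simp

lemma cayley_path_trans:
  assumes "cayley_path \<Gamma> S q r m" "cayley_path \<Gamma> S p q l"
  shows "cayley_path \<Gamma> S p r (l + m)"
  using assms
proof (induction rule: cayley_path.induct)
  case (step p' g s a m b)
  have "cayley_path \<Gamma> S p (edge_point \<Gamma> g s b) ((l + m) + \<bar>b - a\<bar>)"
    by (intro cayley_path.step step)
  then show ?case by (simp add: add.assoc)
qed simp

lemma cayley_path_sym:
  assumes "cayley_path \<Gamma> S p q l" "group \<Gamma>" "S \<subseteq> carrier \<Gamma>"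
  shows "cayley_path \<Gamma> S q p l"
  using assms
proof (induction rule: cayley_path.induct)
  case (refl p)
  then show ?case by (blast intro: cayley_path.refl)
next
  case (step p g s a l b)
  have "cayley_path \<Gamma> S (edge_point \<Gamma> g s b) (edge_point \<Gamma> g s a) \<bar>a - b\<bar>"
    using step by (intro cayley_path_edge) auto
  from cayley_path_trans[OF step.IH[OF step.prems] this] show ?case
    by (simp add: add.commute abs_minus_commute)
qed

lemma cayley_path_exists:
  assumes \<Gamma>: "group \<Gamma>" and S: "S \<subseteq> carrier \<Gamma>" and gen: "generate \<Gamma> S = carrier \<Gamma>"
    and p: "p \<in> cayley_graph \<Gamma> S" and q: "q \<in> cayley_graph \<Gamma> S"
  shows "\<exists>l. cayley_path \<Gamma> S p q l"
proof -
  interpret group \<Gamma> by (rule \<Gamma>)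
  have fwd: "cayley_path \<Gamma> S (Vertex g) (Vertex (g \<otimes>\<^bsub>\<Gamma>\<^esub> s)) 1" if "g \<in> carrier \<Gamma>" "s \<in> S" for g s
    using cayley_path_edge[OF \<Gamma> S that, of 0 1] by (simp add: edge_point_def)
  have vert: "\<exists>l. cayley_path \<Gamma> S (Vertex g) (Vertex (g \<otimes>\<^bsub>\<Gamma>\<^esub> h)) l"
    if "h \<in> generate \<Gamma> S" "g \<in> carrier \<Gamma>" for g h
    using that
  proof (induction arbitrary: g rule: generate.induct)
    case one
    then show ?case by (auto intro!: exI[of _ 0] cayley_path.refl simp: cayley_graph_def)
  next
    case (incl h)
    then show ?case using fwd by blast
  next
    case (inv h)
    then have h: "h \<in> carrier \<Gamma>" using S by auto
    have "cayley_path \<Gamma> S (Vertex (g \<otimes>\<^bsub>\<Gamma>\<^esub> inv\<^bsub>\<Gamma>\<^esub> h)) (Vertex g) 1"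
      using fwd[of "g \<otimes>\<^bsub>\<Gamma>\<^esub> inv\<^bsub>\<Gamma>\<^esub> h" h] inv h by (simp add: m_assoc)
    then show ?case using cayley_path_sym \<Gamma> S by blast
  next
    case (eng h1 h2)
    have h: "h1 \<in> carrier \<Gamma>" "h2 \<in> carrier \<Gamma>"
      using eng gen by auto
    obtain l m where "cayley_path \<Gamma> S (Vertex g) (Vertex (g \<otimes>\<^bsub>\<Gamma>\<^esub> h1)) l"
      "cayley_path \<Gamma> S (Vertex (g \<otimes>\<^bsub>\<Gamma>\<^esub> h1)) (Vertex (g \<otimes>\<^bsub>\<Gamma>\<^esub> h1 \<otimes>\<^bsub>\<Gamma>\<^esub> h2)) m"
      using eng.IH(1)[OF eng.prems] eng.IH(2)[of "g \<otimes>\<^bsub>\<Gamma>\<^esub> h1"] eng.prems h by auto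
    then show ?case
      using cayley_path_trans h eng.prems by (metis m_assoc)
  qed
  have one: "\<exists>g l. g \<in> carrier \<Gamma> \<and> cayley_path \<Gamma> S x (Vertex g) l" if "x \<in> cayley_graph \<Gamma> S" for x
    using that unfolding cayley_graph_def
  proof (elim UnE imageE CollectE exE conjE)
    fix g assume "x = Vertex g" "g \<in> carrier \<Gamma>"
    then show ?thesis by (auto simp: cayley_graph_def intro!: exI[of _ g] exI[of _ 0] cayley_path.refl)
  next
    fix g s t assume x: "x = Interior g s t" "g \<in> carrier \<Gamma>" "s \<in> S" "0 < t" "t < 1"
    then show ?thesis
      using cayley_path_edge[OF \<Gamma> S x(2,3), of t 0] by (auto simp: edge_point_def)
  qed
  obtain g l where g: "g \<in> carrier \<Gamma>" "cayley_path \<Gamma> S p (Vertex g) l" using one[OF p] by blast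
  obtain h m where h: "h \<in> carrier \<Gamma>" "cayley_path \<Gamma> S q (Vertex h) m" using one[OF q] by blast
  have "inv\<^bsub>\<Gamma>\<^esub> g \<otimes>\<^bsub>\<Gamma>\<^esub> h \<in> generate \<Gamma> S" "g \<otimes>\<^bsub>\<Gamma>\<^esub> (inv\<^bsub>\<Gamma>\<^esub> g \<otimes>\<^bsub>\<Gamma>\<^esub> h) = h"
    using g h gen by (simp_all add: m_assoc[symmetric])
  then obtain n where "cayley_path \<Gamma> S (Vertex g) (Vertex h) n"
    using vert[OF _ g(1)] by metis
  then show ?thesis
    using g h cayley_path_trans cayley_path_sym \<Gamma> S by metis
qed

text \<open>
  Distinct points have positive distance: this is seen from a function that is \<open>1\<close>-Lipschitz
  on every edge and vanishes at one point only.
\<close>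

lemma cayley_path_lipschitz:
  fixes f :: "'a cayley_point \<Rightarrow> real"
  assumes "cayley_path \<Gamma> S p q l"
    and "\<And>g s a b. \<lbrakk>g \<in> carrier \<Gamma>; s \<in> S; a \<in> {0..1}; b \<in> {0..1}\<rbrakk>
      \<Longrightarrow> f (edge_point \<Gamma> g s b) - f (edge_point \<Gamma> g s a) \<le> \<bar>b - a\<bar>"
  shows "f q - f p \<le> l"
  using assms(1)
proof (induction rule: cayley_path.induct)
  case (step p g s a l b)
  then show ?case using assms(2)[of g s a b] by simp
qed simp

lemma cayley_path_bound:
  assumes p: "p \<in> cayley_graph \<Gamma> S" and q: "q \<in> cayley_graph \<Gamma> S" and pq: "p \<noteq> q"
  shows "\<exists>e>0. \<forall>l. cayley_path \<Gamma> S p q l \<longrightarrow> e \<le> l"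
proof (cases p)
  case (Vertex v)
  define f :: "'a cayley_point \<Rightarrow> real" where
    "f x = (case x of Vertex g \<Rightarrow> if g = v then 0 else 1 / 2
      | Interior g s t \<Rightarrow> min (1 / 2) (min (if g = v then t else 1) (if g \<otimes>\<^bsub>\<Gamma>\<^esub> s = v then 1 - t else 1)))"
    for x
  have "f q - f p \<le> l" if "cayley_path \<Gamma> S p q l" for l
    using that by (rule cayley_path_lipschitz) (auto simp: f_def edge_point_def)
  moreover have "f q - f p > 0"
    using Vertex pq q by (auto simp: f_def cayley_graph_def split: if_splits)
  ultimately show ?thesis by blast
next
  case (Interior h u r)
  then have r: "0 < r" "r < 1" using p by (auto simp: cayley_graph_def)
  define e where "e = min r (1 - r)"
  define f :: "'a cayley_point \<Rightarrow> real" where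
    "f x = (case x of Vertex g \<Rightarrow> e
      | Interior g s t \<Rightarrow> if g = h \<and> s = u then min e \<bar>t - r\<bar> else e)" for x
  have "f q - f p \<le> l" if "cayley_path \<Gamma> S p q l" for l
    using that by (rule cayley_path_lipschitz) (use r in \<open>auto simp: f_def e_def edge_point_def\<close>)
  moreover have "f q - f p > 0"
    using Interior pq r by (cases q) (auto simp: f_def e_def)
  ultimately show ?thesis by blast
qed

lemma Metric_space_cayley_graph:
  assumes \<Gamma>: "group \<Gamma>" and S: "S \<subseteq> carrier \<Gamma>" and gen: "generate \<Gamma> S = carrier \<Gamma>"
  shows "Metric_space (cayley_graph \<Gamma> S) (cayley_dist \<Gamma> S)"
proof
  let ?L = "\<lambda>p q. {l. cayley_path \<Gamma> S p q l}"
  have nonempty: "?L p q \<noteq> {}" if "p \<in> cayley_graph \<Gamma> S" "q \<in> cayley_graph \<Gamma> S" for p q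
    using cayley_path_exists[OF \<Gamma> S gen that] by blast
  have bdd: "bdd_below (?L p q)" for p q
    using cayley_path_in_graph \<Gamma> S by (intro bdd_belowI[of _ 0]) blast
  show nn: "0 \<le> cayley_dist \<Gamma> S p q" for p q
    unfolding cayley_dist_def
    using nonempty[of p q] cayley_path_in_graph[OF _ \<Gamma> S, of p q]
    by (auto intro!: cInf_greatest split: if_splits)
  have "?L p q = ?L q p" for p q
    using cayley_path_sym[OF _ \<Gamma> S] by blast
  then show "cayley_dist \<Gamma> S p q = cayley_dist \<Gamma> S q p" for p q
    by (simp add: cayley_dist_def)
  fix p q assume p: "p \<in> cayley_graph \<Gamma> S" and q: "q \<in> cayley_graph \<Gamma> S"
  show "cayley_dist \<Gamma> S p q = 0 \<longleftrightarrow> p = q"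
  proof
    assume "p = q"
    then have "cayley_path \<Gamma> S p q 0" using p cayley_path.refl by blast
    then have "cayley_dist \<Gamma> S p q \<le> 0"
      using p q bdd by (auto simp: cayley_dist_def intro!: cInf_lower)
    with nn show "cayley_dist \<Gamma> S p q = 0" by (simp add: antisym)
  next
    assume 0: "cayley_dist \<Gamma> S p q = 0"
    show "p = q"
    proof (rule ccontr)
      assume "p \<noteq> q"
      then obtain e where "e > 0" "\<And>l. cayley_path \<Gamma> S p q l \<Longrightarrow> e \<le> l"
        using cayley_path_bound[OF p q] by blast
      then have "e \<le> cayley_dist \<Gamma> S p q"
        using p q nonempty[OF p q] by (auto simp: cayley_dist_def intro!: cInf_greatest)
      with 0 \<open>e > 0\<close> show False by simp
    qed
  qed
  fix r assume r: "r \<in> cayley_graph \<Gamma> S"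
  have "Inf (?L p r) \<le> l + m" if "l \<in> ?L p q" "m \<in> ?L q r" for l m
    using that cayley_path_trans[of \<Gamma> S q r m p l] by (intro cInf_lower bdd) auto
  then have "Inf (?L p r) - m \<le> Inf (?L p q)" if "m \<in> ?L q r" for m
    using that nonempty[OF p q] by (intro cInf_greatest) (auto simp: algebra_simps)
  then have "Inf (?L p r) - Inf (?L p q) \<le> Inf (?L q r)"
    using nonempty[OF q r] by (intro cInf_greatest) (auto simp: algebra_simps)
  then show "cayley_dist \<Gamma> S p r \<le> cayley_dist \<Gamma> S p q + cayley_dist \<Gamma> S q r"
    using p q r by (simp add: cayley_dist_def)
qed


definition hyperbolic_group :: "('a, 'm) monoid_scheme \<Rightarrow> bool" where
  "hyperbolic_group \<Gamma> \<longleftrightarrow> group \<Gamma> \<and>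
    (\<exists>S \<subseteq> carrier \<Gamma>. finite S \<and> generate \<Gamma> S = carrier \<Gamma> \<and>
      (\<exists>\<delta>. Metric_space.delta_hyperbolic (cayley_graph \<Gamma> S) (cayley_dist \<Gamma> S) \<delta>))"

end

theory Submission
  imports Defs
begin

text \<open>
  Let \<open>g \<noteq> 1\<close> have order \<open>n\<close>, let \<open>s = 1 + g + \<dots> + g\<^sup>n\<^sup>-\<^sup>1\<close>, and suppose that \<open>U(KG)\<close> is
  hyperbolic. Two facts about hyperbolic groups suffice: a set of torsion elements centralised
  by an infinite set is finite, and there is no subgroup \<open>\<int>\<^sup>2\<close>. By the first one, a set \<open>V\<close> with
  \<open>V V = 0\<close> is finite, because \<open>1 + V\<close> consists of commuting elements of order \<open>p\<close> or \<open>1\<close>.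
  The elements \<open>(1 - g) h s\<close> form such a set, so \<open>g h s = h s\<close> for all but finitely many
  \<open>h \<in> G\<close>; symmetrically \<open>s h g = s h\<close>.

  If \<open>n = 0\<close> in \<open>K\<close>, then \<open>s\<^sup>2 = 0\<close>, and the sets of all \<open>k s\<close> with \<open>k \<in> K\<close> and of all \<open>h s\<close> with
  \<open>g h s = h s\<close> are of the same kind, which bounds \<open>K\<close> and \<open>G\<close>. Otherwise \<open>e = s / n\<close> is
  an idempotent commuting with all but finitely many \<open>h \<in> G\<close>. For a set \<open>W\<close> of units
  commuting with \<open>e\<close> the units \<open>w e + (1 - e)\<close> and \<open>e + w (1 - e)\<close> commute with each
  other; if \<open>W\<close> is infinite and torsion this contradicts the first fact, and if
  \<open>w \<in> W\<close> has infinite order it contradicts the second. Apply this to the nonzero scalars and to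
  the elements of \<open>G\<close> that commute with \<open>e\<close>.
\<close>

section \<open>Commuting sets in hyperbolic groups\<close>

text \<open>What is kept of a hyperbolic Cayley graph: the distances between vertices as natural
  numbers. \<open>interpolate\<close> provides discrete geodesics from the identity, and
  \<open>four_point\<close> is Gromov's inequality with the base point made symmetric, so that
  \<open>D\<close> plays the role of twice delta.\<close>

locale hyperbolic_word_metric = group \<Gamma> for \<Gamma> (structure) +
  fixes d :: "'a \<Rightarrow> 'a \<Rightarrow> nat" and D :: nat
  assumes d_refl: "x \<in> carrier \<Gamma> \<Longrightarrow> d x x = 0"
    and d_sym: "\<lbrakk>x \<in> carrier \<Gamma>; y \<in> carrier \<Gamma>\<rbrakk> \<Longrightarrow> d x y = d y x"
    and d_triangle: "\<lbrakk>x \<in> carrier \<Gamma>; y \<in> carrier \<Gamma>; z \<in> carrier \<Gamma>\<rbrakk> \<Longrightarrow> d x z \<le> d x y + d y z"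
    and d_mult_left: "\<lbrakk>x \<in> carrier \<Gamma>; y \<in> carrier \<Gamma>; z \<in> carrier \<Gamma>\<rbrakk>
      \<Longrightarrow> d (z \<otimes> x) (z \<otimes> y) = d x y"
    and finite_ball: "finite {x \<in> carrier \<Gamma>. d \<one> x \<le> r}"
    and interpolate: "\<lbrakk>x \<in> carrier \<Gamma>; i \<le> d \<one> x\<rbrakk>
      \<Longrightarrow> \<exists>y\<in>carrier \<Gamma>. d \<one> y = i \<and> i + d y x = d \<one> x"
    and four_point: "\<lbrakk>x \<in> carrier \<Gamma>; y \<in> carrier \<Gamma>; z \<in> carrier \<Gamma>; w \<in> carrier \<Gamma>\<rbrakk>
      \<Longrightarrow> d x y + d z w \<le> d x z + d y w + D \<or> d x y + d z w \<le> d x w + d y z + D"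
begin

text \<open>The point \<open>f \<otimes> m\<close> lies on the translated geodesic from
  \<open>f\<close> to \<open>f \<otimes> b = b \<otimes> f\<close>, whose ends are at distance
  \<open>d \<one> f\<close> from \<open>\<one>\<close> and \<open>b\<close>. Away from the ends the
  defect no longer depends on \<open>f\<close>: the distance \<open>d \<one> (f \<otimes> b)\<close>
  occurs on opposite sides of two four-point inequalities and cancels in their sum.\<close>

lemma translate_near_segment:
  assumes c: "f \<in> carrier \<Gamma>" "b \<in> carrier \<Gamma>" "m \<in> carrier \<Gamma>" and comm: "f \<otimes> b = b \<otimes> f"
    and m: "d \<one> m + d m b = d \<one> b"
    and mid: "d \<one> f + D < d \<one> m" "2 * d \<one> f + D < d m b"
  shows "d \<one> (f \<otimes> m) + d (f \<otimes> m) b \<le> d \<one> b + 2 * D"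
proof -
  have [simp]: "f \<otimes> m \<in> carrier \<Gamma>" "f \<otimes> b \<in> carrier \<Gamma>" using c by auto
  have e: "d f (f \<otimes> m) = d \<one> m" "d (f \<otimes> m) (f \<otimes> b) = d m b" "d f (f \<otimes> b) = d \<one> b"
    "d b (f \<otimes> b) = d \<one> f"
    using c d_mult_left[of \<one> m f] d_mult_left[of m b f] d_mult_left[of \<one> b f]
      d_mult_left[of \<one> f b] comm by auto
  have s: "d (f \<otimes> b) b = d \<one> f" "d f \<one> = d \<one> f" "d (f \<otimes> m) \<one> = d \<one> (f \<otimes> m)" "d (f\<otimes>b) \<one> = d \<one> (f\<otimes>b)"
     "d b \<one> = d \<one> b" "d (f \<otimes> m) f = d \<one> m" "d (f \<otimes> b) (f \<otimes> m) = d m b" "d (f \<otimes> b) f = d \<one> b"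
     "d b (f \<otimes> m) = d (f \<otimes> m) b"
    using e c by (auto simp: d_sym)
  \<comment> \<open>The first alternative would force \<open>m\<close> to be close to
    \<open>\<one>\<close>, so the second one holds.\<close>
  have "d \<one> (f \<otimes> m) + d f (f \<otimes> b) \<le> d \<one> f + d (f \<otimes> m) (f \<otimes> b) + D \<or>
        d \<one> (f \<otimes> m) + d f (f \<otimes> b) \<le> d \<one> (f \<otimes> b) + d (f \<otimes> m) f + D"
    using c by (intro four_point) auto
  moreover have "d f (f \<otimes> m) \<le> d f \<one> + d \<one> (f \<otimes> m)"
    using c by (intro d_triangle) auto
  ultimately have 1: "d \<one> (f \<otimes> m) + d \<one> b \<le> d \<one> (f \<otimes> b) + d \<one> m + D"
    using mid m e s by linarith
  \<comment> \<open>Likewise the first alternative would force \<open>m\<close> to be close to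
    \<open>b\<close>.\<close>
  have "d (f \<otimes> m) b + d \<one> (f \<otimes> b) \<le> d (f \<otimes> m) \<one> + d b (f \<otimes> b) + D \<or>
        d (f \<otimes> m) b + d \<one> (f \<otimes> b) \<le> d (f \<otimes> m) (f \<otimes> b) + d b \<one> + D"
    using c by (intro four_point) auto
  moreover have "d \<one> (f \<otimes> m) \<le> d \<one> f + d f (f \<otimes> m)"
    using c by (intro d_triangle) auto
  moreover have "d (f \<otimes> b) (f \<otimes> m) \<le> d (f \<otimes> b) b + d b (f \<otimes> m)"
    using c by (intro d_triangle) auto
  moreover have "d f (f \<otimes> b) \<le> d f \<one> + d \<one> (f \<otimes> b)"
    using c by (intro d_triangle) auto
  ultimately have 2: "d (f \<otimes> m) b + d \<one> (f \<otimes> b) \<le> d m b + d \<one> b + D"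
    using mid m e s by linarith
  show ?thesis using 1 2 m by linarith
qed

text \<open>The drift \<open>d \<one> (f \<otimes> y) - d \<one> y\<close> is nearly the same for
  all \<open>y\<close> close to the segment and far from \<open>\<one>\<close>: it is compared with
  the drift of \<open>b\<close>. The upper bound is a four-point inequality, the lower one a
  triangle inequality.\<close>

lemma shift_along_segment:
  assumes c: "f \<in> carrier \<Gamma>" "b \<in> carrier \<Gamma>" "y \<in> carrier \<Gamma>" and comm: "f \<otimes> b = b \<otimes> f"
    and y: "d \<one> y + d y b \<le> d \<one> b + 2 * D"
    and mid: "2 * d \<one> f + 3 * D < 2 * d \<one> y"
  shows "d \<one> (f \<otimes> y) + d \<one> b \<le> d \<one> (f \<otimes> b) + d \<one> y + D"
    and "d \<one> (f \<otimes> b) + d \<one> y \<le> d \<one> (f \<otimes> y) + d \<one> b + 2 * D"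
proof -
  have e: "d f (f \<otimes> y) = d \<one> y" "d (f \<otimes> y) (f \<otimes> b) = d y b" "d f (f \<otimes> b) = d \<one> b"
    "d (f \<otimes> y) f = d \<one> y" "d f \<one> = d \<one> f"
    using c d_mult_left[of \<one> y f] d_mult_left[of y b f] d_mult_left[of \<one> b f]
      d_sym[of f "f \<otimes> y"] d_sym[of f \<one>] by auto
  have "d \<one> (f \<otimes> y) + d f (f \<otimes> b) \<le> d \<one> f + d (f \<otimes> y) (f \<otimes> b) + D \<or>
        d \<one> (f \<otimes> y) + d f (f \<otimes> b) \<le> d \<one> (f \<otimes> b) + d (f \<otimes> y) f + D"
    using c by (intro four_point) auto
  moreover have "d f (f \<otimes> y) \<le> d f \<one> + d \<one> (f \<otimes> y)"
    using c by (intro d_triangle) auto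
  ultimately show "d \<one> (f \<otimes> y) + d \<one> b \<le> d \<one> (f \<otimes> b) + d \<one> y + D"
    using mid y e by linarith
  have "d \<one> (f \<otimes> b) \<le> d \<one> (f \<otimes> y) + d (f \<otimes> y) (f \<otimes> b)"
    using c by (intro d_triangle) auto
  then show "d \<one> (f \<otimes> b) + d \<one> y \<le> d \<one> (f \<otimes> y) + d \<one> b + 2 * D"
    using y e by linarith
qed

text \<open>A point close to the segment is determined up to a bounded error by its distance from
  \<open>\<one>\<close>. Both alternatives of the four-point inequality for \<open>x\<close>,
  \<open>y\<close> and the two ends of the segment give the bound.\<close>

lemma near_segment_dist:
  assumes c: "x \<in> carrier \<Gamma>" "y \<in> carrier \<Gamma>" "b \<in> carrier \<Gamma>"
    and xy: "d \<one> x + d x b \<le> d \<one> b + 2 * D" "d \<one> y + d y b \<le> d \<one> b + 2 * D"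
    and k: "d \<one> x \<le> d \<one> y + k" "d \<one> y \<le> d \<one> x + k"
  shows "d x y \<le> k + 3 * D"
proof -
  have "d x y + d \<one> b \<le> d x \<one> + d y b + D \<or> d x y + d \<one> b \<le> d x b + d y \<one> + D"
    using c by (intro four_point) auto
  moreover have "d x \<one> = d \<one> x" "d y \<one> = d \<one> y" using c by (auto simp: d_sym)
  ultimately show ?thesis using xy k by linarith
qed

text \<open>Balls are finite, so \<open>B\<close> has an element longer than \<open>2 * R\<close>; a
  geodesic to it is cut at distance \<open>R\<close> from \<open>\<one>\<close>.\<close>

lemma exists_midpoint:
  assumes B: "infinite B" "B \<subseteq> carrier \<Gamma>"
  obtains b m where "b \<in> B" "m \<in> carrier \<Gamma>" "d \<one> m + d m b = d \<one> b" "R \<le> d \<one> m" "R \<le> d m b"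
proof -
  have "\<not> B \<subseteq> {x \<in> carrier \<Gamma>. d \<one> x \<le> 2 * R}"
    using B finite_ball finite_subset by blast
  then obtain b where b: "b \<in> B" "2 * R < d \<one> b" "b \<in> carrier \<Gamma>" using B by force
  then obtain m where "m \<in> carrier \<Gamma>" "d \<one> m = R" "R + d m b = d \<one> b"
    using interpolate[of b R] by auto
  then show thesis using b by (intro that[of b m]) auto
qed

text \<open>Multiplication by \<open>m\<close> on the right is injective, and translating by
  \<open>inv x\<close> moves all the points \<open>f \<otimes> m\<close> into one ball about
  \<open>\<one>\<close>.\<close>

lemma card_translates_near_point:
  assumes "F \<subseteq> carrier \<Gamma>" "x \<in> carrier \<Gamma>" "m \<in> carrier \<Gamma>"
    and "\<And>f. f \<in> F \<Longrightarrow> d x (f \<otimes> m) \<le> r"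
  shows "card F \<le> card {x \<in> carrier \<Gamma>. d \<one> x \<le> r}"
proof (rule card_inj_on_le)
  show "inj_on (\<lambda>f. inv x \<otimes> (f \<otimes> m)) F"
    using assms by (auto simp: inj_on_def subset_iff)
  show "(\<lambda>f. inv x \<otimes> (f \<otimes> m)) ` F \<subseteq> {x \<in> carrier \<Gamma>. d \<one> x \<le> r}"
  proof clarify
    fix f assume f: "f \<in> F"
    then have "f \<in> carrier \<Gamma>" using assms by auto
    then show "inv x \<otimes> (f \<otimes> m) \<in> carrier \<Gamma> \<and> d \<one> (inv x \<otimes> (f \<otimes> m)) \<le> r"
      using assms(2-3) assms(4)[OF f] d_mult_left[of x "f \<otimes> m" "inv x"] by simp
  qed
qed (rule finite_ball)

text \<open>The points \<open>f \<otimes> m\<close> stay near one long geodesic, so they have few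
  possible positions along it, and each position is shared by boundedly many \<open>f\<close>. The
  bound is linear in \<open>R\<close>, which a group of quadratic growth violates.\<close>

lemma card_centralizer_ball_le:
  assumes B: "infinite B" "B \<subseteq> carrier \<Gamma>" and F: "finite F" "F \<subseteq> carrier \<Gamma>"
    and comm: "\<And>f b. \<lbrakk>f \<in> F; b \<in> B\<rbrakk> \<Longrightarrow> f \<otimes> b = b \<otimes> f" and R: "\<And>f. f \<in> F \<Longrightarrow> d \<one> f \<le> R"
  shows "card F \<le> (2 * R + 1) * card {x \<in> carrier \<Gamma>. d \<one> x \<le> 3 * D}"
proof -
  \<comment> \<open>These margins satisfy both inequalities in \<open>translate_near_segment\<close>
    for every \<open>f\<close> of length at most \<open>R\<close>.\<close>
  obtain b m where b: "b \<in> B" and m: "m \<in> carrier \<Gamma>" "d \<one> m + d m b = d \<one> b"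
    "2 * R + D + 1 \<le> d \<one> m" "2 * R + D + 1 \<le> d m b"
    using exists_midpoint[OF B] by metis
  have bc: "b \<in> carrier \<Gamma>" using b B by auto
  have fc: "f \<in> carrier \<Gamma>" if "f \<in> F" for f using that F by auto
  have slack: "d \<one> (f \<otimes> m) + d (f \<otimes> m) b \<le> d \<one> b + 2 * D" if f: "f \<in> F" for f
    using R[OF f] m by (intro translate_near_segment fc[OF f] bc comm[OF f b]) auto
  \<comment> \<open>\<open>F\<close> is sorted by the distance of \<open>f \<otimes> m\<close> from
    \<open>\<one>\<close>, which differs from \<open>d \<one> m\<close> by at most
    \<open>R\<close>.\<close>
  define S where "S = {d \<one> m - R..d \<one> m + R}"
  define Fs where "Fs s = {f \<in> F. d \<one> (f \<otimes> m) = s}" for s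
  have "F \<subseteq> (\<Union>s\<in>S. Fs s)"
  proof
    fix f assume f: "f \<in> F"
    have "d \<one> (f \<otimes> m) \<le> d \<one> f + d f (f \<otimes> m)" "d f (f \<otimes> m) \<le> d f \<one> + d \<one> (f \<otimes> m)"
      using fc[OF f] m(1) by (auto intro!: d_triangle)
    moreover have "d f (f \<otimes> m) = d \<one> m" "d f \<one> = d \<one> f"
      using fc[OF f] m(1) d_mult_left[of \<one> m f] d_sym[of f \<one>] by auto
    ultimately show "f \<in> (\<Union>s\<in>S. Fs s)"
      using R[OF f] f unfolding S_def Fs_def by auto
  qed
  then have "card F \<le> card (\<Union>s\<in>S. Fs s)"
    using F by (intro card_mono) (auto simp: Fs_def S_def)
  also have "\<dots> \<le> (\<Sum>s\<in>S. card (Fs s))"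
    by (intro card_UN_le) (auto simp: S_def)
  also have "\<dots> \<le> card S * card {x \<in> carrier \<Gamma>. d \<one> x \<le> 3 * D}"
  proof -
    have "card (Fs s) \<le> card {x \<in> carrier \<Gamma>. d \<one> x \<le> 3 * D}" for s
    proof (cases "Fs s = {}")
      case False
      then obtain f0 where f0: "f0 \<in> F" "d \<one> (f0 \<otimes> m) = s" by (auto simp: Fs_def)
      show ?thesis
      proof (rule card_translates_near_point)
        fix f assume "f \<in> Fs s"
        then have f: "f \<in> F" "d \<one> (f \<otimes> m) = s" by (auto simp: Fs_def)
        have "d (f0 \<otimes> m) (f \<otimes> m) \<le> 0 + 3 * D"
          using f f0 bc m(1) fc by (intro near_segment_dist[where b = b] slack) auto
        then show "d (f0 \<otimes> m) (f \<otimes> m) \<le> 3 * D" by simp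
      qed (use fc f0 m in \<open>auto simp: Fs_def\<close>)
    qed simp
    then show ?thesis using sum_bounded_above[of S "\<lambda>s. card (Fs s)"] by simp
  qed
  also have "\<dots> \<le> (2 * R + 1) * card {x \<in> carrier \<Gamma>. d \<one> x \<le> 3 * D}"
    by (intro mult_right_mono) (auto simp: S_def)
  finally show ?thesis .
qed

text \<open>
  An element of finite order commuting with a long \<open>b\<close> cannot drift along the segment from
  \<open>\<one>\<close> to \<open>b\<close>, because its drifts add up over the powers; so it moves the midpoint little.
\<close>

lemma finite_torsion_centralizer:
  assumes B: "infinite B" "B \<subseteq> carrier \<Gamma>" and A: "A \<subseteq> torsion_part \<Gamma>"
    and comm: "\<And>a b. \<lbrakk>a \<in> A; b \<in> B\<rbrakk> \<Longrightarrow> a \<otimes> b = b \<otimes> a"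
  shows "finite A"
proof -
  let ?N = "card {x \<in> carrier \<Gamma>. d \<one> x \<le> 6 * D}"
  \<comment> \<open>A uniform bound for finite subsets suffices; \<open>R\<close>, \<open>b\<close>
    and \<open>m\<close> below depend on \<open>F\<close>, but the bound does not.\<close>
  have "card F \<le> ?N" if F: "F \<subseteq> A" "finite F" for F
  proof -
    have fc: "f \<in> carrier \<Gamma>" if "f \<in> F" for f using that F A by (auto simp: torsion_part_def)
    have "\<forall>f\<in>F. \<exists>n::nat. n > 0 \<and> f [^] n = \<one>" using F A by (auto simp: torsion_part_def)
    then obtain n :: "'a \<Rightarrow> nat" where n: "\<And>f. f \<in> F \<Longrightarrow> n f > 0" "\<And>f. f \<in> F \<Longrightarrow> f [^] n f = \<one>"
      by metis
    define P where "P = (\<Union>f\<in>F. (\<lambda>k::nat. f [^] k) ` {..n f})"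
    have "finite P" using F by (auto simp: P_def)
    then obtain R where R: "\<And>x. x \<in> P \<Longrightarrow> d \<one> x \<le> R"
      using finite_nat_set_iff_bounded_le[of "d \<one> ` P"] by auto
    \<comment> \<open>\<open>R\<close> bounds the lengths of all powers up to the exponent
      \<open>n f\<close>, so these margins keep the whole orbit of \<open>m\<close> close to the
      segment and far from \<open>\<one>\<close>.\<close>
    obtain b m where b: "b \<in> B" and m: "m \<in> carrier \<Gamma>" "d \<one> m + d m b = d \<one> b"
      "3 * R + 3 * D + 1 \<le> d \<one> m" "3 * R + 3 * D + 1 \<le> d m b"
      using exists_midpoint[OF B] by metis
    have bc: "b \<in> carrier \<Gamma>" using b B by auto
    show ?thesis
    proof (rule card_translates_near_point)
      fix f assume f: "f \<in> F"
      note fc = fc[OF f]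
      have cm: "f \<otimes> b = b \<otimes> f" using f F b comm by auto
      have cmk: "f [^] k \<otimes> b = b \<otimes> f [^] k" for k :: nat
        using group_commutes_pow[OF cm fc bc] .
      have Rk: "d \<one> (f [^] k) \<le> R" if "k \<le> n f" for k
        using that f by (intro R) (auto simp: P_def)
      have slack: "d \<one> (f [^] k \<otimes> m) + d (f [^] k \<otimes> m) b \<le> d \<one> b + 2 * D" if "k \<le> n f" for k
        using fc bc m Rk[OF that] by (intro translate_near_segment cmk) auto
      have big: "2 * d \<one> f + 3 * D < 2 * d \<one> (f [^] k \<otimes> m)" if k: "k \<le> n f" for k
      proof -
        have "d (f [^] k) (f [^] k \<otimes> m) \<le> d (f [^] k) \<one> + d \<one> (f [^] k \<otimes> m)"
          using fc m by (intro d_triangle) auto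
        moreover have "d (f [^] k) \<one> = d \<one> (f [^] k)" "d (f [^] k) (f [^] k \<otimes> m) = d \<one> m"
          using fc m d_mult_left[of \<one> m "f [^] k"] by (auto simp: d_sym)
        moreover have "d \<one> f \<le> R" using Rk[of 1] n(1)[OF f] fc by simp
        ultimately show ?thesis using Rk[OF k] m by linarith
      qed
      have assoc: "f \<otimes> (f [^] k \<otimes> m) = f [^] Suc k \<otimes> m" for k :: nat
        using fc m by (metis m_assoc nat_pow_Suc2 nat_pow_closed)
      have step: "d \<one> (f [^] Suc k \<otimes> m) + d \<one> b \<le> d \<one> (f \<otimes> b) + d \<one> (f [^] k \<otimes> m) + D"
        "d \<one> (f \<otimes> b) + d \<one> (f [^] k \<otimes> m) \<le> d \<one> (f [^] Suc k \<otimes> m) + d \<one> b + 2 * D"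
        if "k \<le> n f" for k
        using shift_along_segment[OF fc bc _ cm slack[OF that] big[OF that]] fc m
        unfolding assoc by auto
      \<comment> \<open>The upper bounds on the drift are added over \<open>k\<close> steps. At
        \<open>k = n f\<close> the orbit is back at \<open>m\<close>, so the total drift is zero,
        and dividing by \<open>n f\<close> bounds \<open>d \<one> b\<close> by
        \<open>d \<one> (f \<otimes> b) + D\<close>. The lower bounds are summed in the same way
        afterwards.\<close>
      have "k \<le> n f \<Longrightarrow> d \<one> (f [^] k \<otimes> m) + k * d \<one> b \<le> k * d \<one> (f \<otimes> b) + d \<one> m + k * D" for k
      proof (induction k)
        case (Suc k)
        then show ?case using step(1)[of k] by simp
      qed (use m in simp)
      from this[of "n f"] have "n f * d \<one> b \<le> n f * (d \<one> (f \<otimes> b) + D)"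
        using n(2)[OF f] m by (simp add: algebra_simps)
      then have 1: "d \<one> b \<le> d \<one> (f \<otimes> b) + D" using n(1)[OF f] by simp
      have "k \<le> n f \<Longrightarrow> k * d \<one> (f \<otimes> b) + d \<one> m \<le> d \<one> (f [^] k \<otimes> m) + k * d \<one> b + k * (2 * D)" for k
      proof (induction k)
        case (Suc k)
        then show ?case using step(2)[of k] by simp
      qed (use m in simp)
      from this[of "n f"] have "n f * d \<one> (f \<otimes> b) \<le> n f * (d \<one> b + 2 * D)"
        using n(2)[OF f] m by (simp add: algebra_simps)
      then have 2: "d \<one> (f \<otimes> b) \<le> d \<one> b + 2 * D" using n(1)[OF f] by simp
      \<comment> \<open>With both bounds on the drift of \<open>b\<close>, the step at
        \<open>k = 0\<close> shows that \<open>d \<one> (f \<otimes> m)\<close> and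
        \<open>d \<one> m\<close> differ by at most \<open>3 * D\<close>.\<close>
      have "d m (f \<otimes> m) \<le> 3 * D + 3 * D"
        using fc m bc slack[of 1] step[of 0] n(1)[OF f] 1 2
        by - (rule near_segment_dist[where b = b], auto)
      then show "d m (f \<otimes> m) \<le> 6 * D" by simp
    qed (use F fc m in auto)
  qed
  then show ?thesis by (rule finite_if_finite_subsets_card_bdd[THEN conjunct1])
qed

text \<open>The \<open>k * k\<close> distinct products with exponents below \<open>k\<close> have
  length at most \<open>2 * k * M\<close> and commute with the infinite set of all such products.
  Quadratic growth contradicts the linear bound in \<open>card_centralizer_ball_le\<close>.\<close>

lemma no_rank_two_abelian:
  assumes xy: "x \<in> carrier \<Gamma>" "y \<in> carrier \<Gamma>" and comm: "x \<otimes> y = y \<otimes> x"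
    and inj: "inj (\<lambda>(i::nat, j::nat). x [^] i \<otimes> y [^] j)"
  shows False
proof -
  define M where "M = max (d \<one> x) (d \<one> y)"
  define N where "N = card {x \<in> carrier \<Gamma>. d \<one> x \<le> 3 * D}"
  have len_mult: "d \<one> (u \<otimes> v) \<le> d \<one> u + d \<one> v" if "u \<in> carrier \<Gamma>" "v \<in> carrier \<Gamma>" for u v
    using that d_triangle[of \<one> u "u \<otimes> v"] d_mult_left[of \<one> v u] by simp
  have len_pow: "d \<one> (u [^] k) \<le> k * d \<one> u" if "u \<in> carrier \<Gamma>" for u and k :: nat
  proof (induction k)
    case (Suc k)
    then show ?case using len_mult[of "u [^] k" u] that by simp
  qed (simp add: d_refl)
  define h where "h = (\<lambda>(i::nat, j::nat). x [^] i \<otimes> y [^] j)"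
  have hc: "h p \<in> carrier \<Gamma>" for p using xy by (auto simp: h_def split: prod.splits)
  have cxy: "x [^] i \<otimes> y [^] j = y [^] j \<otimes> x [^] i" for i j :: nat
  proof -
    have 1: "x [^] i \<otimes> y = y \<otimes> x [^] i" for i :: nat
      using group_commutes_pow[OF comm xy] .
    show ?thesis using group_commutes_pow[OF 1[symmetric]] xy by auto
  qed
  have swap: "(a \<otimes> b) \<otimes> (c \<otimes> e) = (a \<otimes> c) \<otimes> (b \<otimes> e)" if "b \<otimes> c = c \<otimes> b"
    "a \<in> carrier \<Gamma>" "b \<in> carrier \<Gamma>" "c \<in> carrier \<Gamma>" "e \<in> carrier \<Gamma>" for a b c e
    using that by (metis m_assoc m_closed)
  have hmult: "h (i, j) \<otimes> h (i', j') = h (i + i', j + j')" for i j i' j'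
    using xy swap[OF cxy[symmetric]] by (simp add: h_def nat_pow_mult)
  have comm_h: "h p \<otimes> h q = h q \<otimes> h p" for p q
    by (cases p; cases q) (simp add: hmult add.commute)
  have bound: "k * k \<le> (2 * (2 * k * M) + 1) * N" for k
  proof -
    have "card (h ` ({..<k} \<times> {..<k})) \<le> (2 * (2 * k * M) + 1) * N"
      unfolding N_def
    proof (rule card_centralizer_ball_le[where B = "range h"])
      show "infinite (range h)"
        using inj finite_imageD[of h UNIV] by (auto simp: h_def finite_prod)
      fix f assume "f \<in> h ` ({..<k} \<times> {..<k})"
      then obtain i j where ij: "f = x [^] i \<otimes> y [^] j" "i < k" "j < k" by (auto simp: h_def)
      have "d \<one> f \<le> i * d \<one> x + j * d \<one> y"
        using ij len_mult[of "x [^] i" "y [^] j"] len_pow[of x i] len_pow[of y j] xy by simp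
      also have "\<dots> \<le> k * M + k * M"
        using ij by (intro add_mono mult_mono) (auto simp: M_def)
      finally show "d \<one> f \<le> 2 * k * M" by simp
    qed (use hc comm_h in auto)
    moreover have "inj_on h ({..<k} \<times> {..<k})"
      using inj inj_on_subset unfolding h_def by blast
    ultimately show ?thesis by (simp add: card_image)
  qed
  \<comment> \<open>For this \<open>k\<close> the right side of \<open>bound\<close>, which is
    \<open>4 * k * M * N + N\<close>, is at most
    \<open>k * (4 * M * N + N) = k * (k - 1)\<close>.\<close>
  have "(4 * M * N + N + 1) * (4 * M * N + N + 1) \<le> (4 * M * N + N + 1) * (4 * M * N + N)"
    using bound[of "4 * M * N + N + 1"] by (simp add: algebra_simps)
  then show False by simp
qed

end

section \<open>Cayley graphs and word length\<close>

text \<open>The ball of radius \<open>n\<close> about the identity in the word metric of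
  \<open>S\<close> and its inverses. It grows by right multiplication because the edges of the
  Cayley graph join \<open>g\<close> to \<open>g s\<close>.\<close>

primrec word_ball :: "('a, 'm) monoid_scheme \<Rightarrow> 'a set \<Rightarrow> nat \<Rightarrow> 'a set" where
  "word_ball \<Gamma> S 0 = {\<one>\<^bsub>\<Gamma>\<^esub>}"
| "word_ball \<Gamma> S (Suc n) =
    word_ball \<Gamma> S n \<union> (\<Union>g\<in>word_ball \<Gamma> S n. \<Union>s\<in>S. {g \<otimes>\<^bsub>\<Gamma>\<^esub> s, g \<otimes>\<^bsub>\<Gamma>\<^esub> inv\<^bsub>\<Gamma>\<^esub> s})"

definition word_length :: "('a, 'm) monoid_scheme \<Rightarrow> 'a set \<Rightarrow> 'a \<Rightarrow> nat" where
  "word_length \<Gamma> S g = (LEAST n. g \<in> word_ball \<Gamma> S n)"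

locale generated_group = group \<Gamma> for \<Gamma> (structure) +
  fixes S
  assumes S_sub: "S \<subseteq> carrier \<Gamma>" and gen: "generate \<Gamma> S = carrier \<Gamma>"
begin

abbreviation "wball \<equiv> word_ball \<Gamma> S"
abbreviation "len \<equiv> word_length \<Gamma> S"

lemma S_closed: "s \<in> S \<Longrightarrow> s \<in> carrier \<Gamma>"
  using S_sub by auto

lemma ball_closed: "g \<in> wball n \<Longrightarrow> g \<in> carrier \<Gamma>"
  by (induction n arbitrary: g) (auto simp: S_closed)

lemma finite_word_ball: "finite S \<Longrightarrow> finite (wball n)"
  by (induction n) auto

lemma ball_mono: "m \<le> n \<Longrightarrow> wball m \<subseteq> wball n"
  by (rule lift_Suc_mono_le[of wball]) auto

lemma ball_mult: "\<lbrakk>x \<in> wball m; y \<in> wball n\<rbrakk> \<Longrightarrow> x \<otimes> y \<in> wball (m + n)"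
proof (induction n arbitrary: y)
  case 0
  then show ?case using ball_closed[of x m] by simp
next
  case (Suc n)
  have x: "x \<in> carrier \<Gamma>" using Suc.prems ball_closed by auto
  from Suc.prems(2) consider "y \<in> wball n"
    | g s where "g \<in> wball n" "s \<in> S" "y = g \<otimes> s \<or> y = g \<otimes> inv s" by auto
  then show ?case
  proof cases
    case 1
    then show ?thesis using Suc by auto
  next
    case 2
    then have "x \<otimes> g \<in> wball (m + n)" "x \<otimes> y = x \<otimes> g \<otimes> s \<or> x \<otimes> y = x \<otimes> g \<otimes> inv s"
      using Suc x ball_closed[of g n] S_closed[of s] by (auto simp: m_assoc)
    then show ?thesis using 2 by auto
  qed
qed

lemma ball_gen: "s \<in> S \<Longrightarrow> s \<in> wball 1" "s \<in> S \<Longrightarrow> inv s \<in> wball 1"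
  by (auto simp: S_closed intro!: bexI[of _ s])

lemma ball_inv: "x \<in> wball n \<Longrightarrow> inv x \<in> wball n"
proof (induction n arbitrary: x)
  case (Suc n)
  from Suc.prems consider "x \<in> wball n"
    | g s where "g \<in> wball n" "s \<in> S" "x = g \<otimes> s \<or> x = g \<otimes> inv s" by auto
  then show ?case
  proof cases
    case 2
    have "inv x = inv s \<otimes> inv g \<or> inv x = s \<otimes> inv g"
      using 2 ball_closed[of g n] S_closed[of s] by (auto simp: inv_mult_group)
    moreover have "s \<otimes> inv g \<in> wball (Suc n)" "inv s \<otimes> inv g \<in> wball (Suc n)"
      using ball_mult[OF ball_gen(1)[OF 2(2)] Suc.IH[OF 2(1)]]
        ball_mult[OF ball_gen(2)[OF 2(2)] Suc.IH[OF 2(1)]] by simp_all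
    ultimately show ?thesis by (elim disjE) (simp_all only:)
  qed (use Suc in auto)
qed simp

lemma ball_exhausts: "g \<in> carrier \<Gamma> \<Longrightarrow> \<exists>n. g \<in> wball n"
  unfolding gen[symmetric]
proof (induction rule: generate.induct)
  case one
  then show ?case by (auto intro: exI[of _ 0])
qed (use ball_gen ball_mult in blast)+

text \<open>A word is cut in two; this is the source of the discrete geodesics in
  \<open>len_interpolate\<close>.\<close>

lemma ball_split: "x \<in> wball (m + n) \<Longrightarrow> \<exists>y\<in>wball m. \<exists>z\<in>wball n. x = y \<otimes> z"
proof (induction n arbitrary: x)
  case 0
  then show ?case using ball_closed[of x m] by (auto intro!: bexI[of _ x])
next
  case (Suc n)
  then consider "x \<in> wball (m + n)"
    | g s where "g \<in> wball (m + n)" "s \<in> S" "x = g \<otimes> s \<or> x = g \<otimes> inv s" by auto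
  then show ?case
  proof cases
    case 1
    then show ?thesis using Suc.IH by fastforce
  next
    case 2
    then obtain y z where yz: "y \<in> wball m" "z \<in> wball n" "g = y \<otimes> z" using Suc.IH by blast
    then have "x = y \<otimes> (z \<otimes> s) \<or> x = y \<otimes> (z \<otimes> inv s)"
      using 2 ball_closed[of y m] ball_closed[of z n] S_closed[of s] by (auto simp: m_assoc)
    moreover have "z \<otimes> s \<in> wball (Suc n)" "z \<otimes> inv s \<in> wball (Suc n)" using 2 yz by auto
    ultimately show ?thesis using yz by blast
  qed
qed

lemma in_ball_len: "g \<in> carrier \<Gamma> \<Longrightarrow> g \<in> wball (len g)"
  unfolding word_length_def using ball_exhausts by (rule LeastI_ex)

lemma len_le: "g \<in> wball n \<Longrightarrow> len g \<le> n"
  unfolding word_length_def by (rule Least_le)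

lemma len_one [simp]: "len \<one> = 0"
  using len_le[of \<one> 0] by simp

lemma len_mult: "\<lbrakk>x \<in> carrier \<Gamma>; y \<in> carrier \<Gamma>\<rbrakk> \<Longrightarrow> len (x \<otimes> y) \<le> len x + len y"
  by (intro len_le ball_mult in_ball_len)

lemma len_inv: "x \<in> carrier \<Gamma> \<Longrightarrow> len (inv x) = len x"
  using len_le[OF ball_inv[OF in_ball_len[of x]]] len_le[OF ball_inv[OF in_ball_len[of "inv x"]]]
  by simp

lemma len_gen: "s \<in> S \<Longrightarrow> len s \<le> 1"
  using ball_gen by (intro len_le) auto

lemma len_interpolate:
  assumes "x \<in> carrier \<Gamma>" "i \<le> len x"
  shows "\<exists>y\<in>carrier \<Gamma>. len y = i \<and> i + len (inv y \<otimes> x) = len x"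
proof -
  have "x \<in> wball (i + (len x - i))" using assms in_ball_len by simp
  then obtain y z where yz: "y \<in> wball i" "z \<in> wball (len x - i)" "x = y \<otimes> z"
    using ball_split by blast
  then have c: "y \<in> carrier \<Gamma>" "z \<in> carrier \<Gamma>" using ball_closed by auto
  \<comment> \<open>The first three inequalities force equality in the first two.\<close>
  have "len y \<le> i" "len z \<le> len x - i" "len x \<le> len y + len z" "inv y \<otimes> x = z"
    using yz c len_le len_mult by (auto simp: m_assoc[symmetric])
  then show ?thesis using c assms by (intro bexI[of _ y]) auto
qed

section \<open>Distances between vertices of the Cayley graph\<close>

lemma cayley_path_word_ball:
  assumes "x \<in> wball n" "g \<in> carrier \<Gamma>"
  shows "\<exists>l\<le>real n. cayley_path \<Gamma> S (Vertex g) (Vertex (g \<otimes> x)) l"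
  using assms(1)
proof (induction n arbitrary: x)
  case 0
  then show ?case
    using assms(2) by (auto simp: cayley_graph_def intro!: exI[of _ 0] cayley_path.refl)
next
  case (Suc n)
  from Suc.prems consider "x \<in> wball n"
    | h s where "h \<in> wball n" "s \<in> S" "x = h \<otimes> s \<or> x = h \<otimes> inv s" by auto
  then show ?case
  proof cases
    case 1
    then show ?thesis using Suc.IH by (meson le_SucI of_nat_le_iff order_trans order_refl)
  next
    case 2
    then obtain l where l: "l \<le> real n" "cayley_path \<Gamma> S (Vertex g) (Vertex (g \<otimes> h)) l"
      using Suc.IH by blast
    have c: "h \<in> carrier \<Gamma>" "s \<in> carrier \<Gamma>" using 2 ball_closed S_closed by auto
    have edge: "cayley_path \<Gamma> S (Vertex k) (Vertex (k \<otimes> s)) 1" if "k \<in> carrier \<Gamma>" for k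
      using cayley_path_edge[OF is_group S_sub that 2(2), of 0 1] by (simp add: edge_point_def)
    have "cayley_path \<Gamma> S (Vertex (g \<otimes> h)) (Vertex (g \<otimes> x)) 1"
      using 2(3)
    proof
      assume x: "x = h \<otimes> inv s"
      have "cayley_path \<Gamma> S (Vertex (g \<otimes> x)) (Vertex (g \<otimes> x \<otimes> s)) 1"
        using edge c assms x by auto
      moreover have "g \<otimes> x \<otimes> s = g \<otimes> h" using x c assms by (simp add: m_assoc)
      ultimately show ?thesis using cayley_path_sym is_group S_sub by metis
    qed (use edge[of "g \<otimes> h"] c assms in \<open>simp add: m_assoc\<close>)
    then have "cayley_path \<Gamma> S (Vertex g) (Vertex (g \<otimes> x)) (l + 1)"
      using l cayley_path_trans by metis
    then show ?thesis using l by (intro exI[of _ "l + 1"]) auto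
  qed
qed

text \<open>Word length measured from \<open>g\<close> extends to a function on the whole graph that
  is 1-Lipschitz on every edge, so a path is at least as long as the difference of the values at its
  ends.\<close>

lemma cayley_path_length_ge:
  assumes p: "cayley_path \<Gamma> S (Vertex g) (Vertex h) l" and c: "g \<in> carrier \<Gamma>"
  shows "real (len (inv g \<otimes> h)) \<le> l"
proof -
  define w where "w x = real (len (inv g \<otimes> x))" for x
  \<comment> \<open>On an open edge the shorter way through one of its two ends is taken. The values
    of \<open>w\<close> at the ends differ by at most 1, so the same formula is correct for
    \<open>t = 0\<close> and \<open>t = 1\<close>.\<close>
  define f where "f x = (case x of Vertex x \<Rightarrow> w x
    | Interior x s t \<Rightarrow> min (w x + t) (w (x \<otimes> s) + (1 - t)))" for x
  have w: "w (x \<otimes> s) \<le> w x + 1 \<and> w x \<le> w (x \<otimes> s) + 1" if x: "x \<in> carrier \<Gamma>" "s \<in> S" for x s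
  proof -
    have s: "s \<in> carrier \<Gamma>" "len s \<le> 1" using x S_closed len_gen by auto
    have "len (inv g \<otimes> x \<otimes> s) \<le> len (inv g \<otimes> x) + len s"
      using c x s by (intro len_mult) auto
    moreover have "len (inv g \<otimes> (x \<otimes> s) \<otimes> inv s) \<le> len (inv g \<otimes> (x \<otimes> s)) + len (inv s)"
      using c x s by (intro len_mult) auto
    ultimately show ?thesis using c x s by (simp add: w_def m_assoc len_inv)
  qed
  have "f (Vertex h) - f (Vertex g) \<le> l"
    using p
  proof (rule cayley_path_lipschitz)
    fix x s and a b :: real
    assume "x \<in> carrier \<Gamma>" "s \<in> S" and ab: "a \<in> {0..1}" "b \<in> {0..1}"
    have edge: "f (edge_point \<Gamma> x s t) = min (w x + t) (w (x \<otimes> s) + (1 - t))" for t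
      using w[OF \<open>x \<in> carrier \<Gamma>\<close> \<open>s \<in> S\<close>] by (auto simp: f_def edge_point_def)
    show "f (edge_point \<Gamma> x s b) - f (edge_point \<Gamma> x s a) \<le> \<bar>b - a\<bar>"
      unfolding edge by linarith
  qed
  then show ?thesis using c by (simp add: f_def w_def)
qed

lemma cayley_dist_vertex:
  assumes "g \<in> carrier \<Gamma>" "h \<in> carrier \<Gamma>"
  shows "cayley_dist \<Gamma> S (Vertex g) (Vertex h) = real (len (inv g \<otimes> h))"
proof -
  have gh: "g \<otimes> (inv g \<otimes> h) = h" using assms by (simp add: m_assoc[symmetric])
  obtain l where l: "l \<le> real (len (inv g \<otimes> h))" "cayley_path \<Gamma> S (Vertex g) (Vertex h) l"
    using cayley_path_word_ball[OF in_ball_len[of "inv g \<otimes> h"] assms(1)] assms gh by auto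
  have "Inf {l. cayley_path \<Gamma> S (Vertex g) (Vertex h) l} = real (len (inv g \<otimes> h))"
  proof (rule antisym)
    show "Inf {l. cayley_path \<Gamma> S (Vertex g) (Vertex h) l} \<le> real (len (inv g \<otimes> h))"
      using l cayley_path_length_ge[OF _ assms(1)]
      by (intro order_trans[OF cInf_lower l(1)]) (auto intro!: bdd_belowI)
    show "real (len (inv g \<otimes> h)) \<le> Inf {l. cayley_path \<Gamma> S (Vertex g) (Vertex h) l}"
      using l cayley_path_length_ge[OF _ assms(1)] by (intro cInf_greatest) auto
  qed
  then show ?thesis using assms by (simp add: cayley_dist_def cayley_graph_def)
qed

text \<open>Clearing the factor one half in the Gromov products doubles \<open>\<delta>\<close>; the
  result is rounded up because the word metric takes natural values.\<close>

lemma word_metric_hyperbolic: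
  assumes "finite S" "Metric_space.delta_hyperbolic (cayley_graph \<Gamma> S) (cayley_dist \<Gamma> S) \<delta>"
  shows "hyperbolic_word_metric \<Gamma> (\<lambda>x y. len (inv x \<otimes> y)) (nat \<lceil>2 * \<delta>\<rceil>)"
proof
  let ?d = "\<lambda>x y. len (inv x \<otimes> y)"
  interpret Metric_space "cayley_graph \<Gamma> S" "cayley_dist \<Gamma> S"
    by (rule Metric_space_cayley_graph[OF is_group S_sub gen])
  fix x y z assume x: "x \<in> carrier \<Gamma>"
  show "?d x x = 0" using x by simp
  show "\<exists>y\<in>carrier \<Gamma>. ?d \<one> y = i \<and> i + ?d y x = ?d \<one> x" if "i \<le> ?d \<one> x" for i
    using len_interpolate[of x i] x that by auto
  assume y: "y \<in> carrier \<Gamma>"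
  show sym: "?d x y = ?d y x" using len_inv[of "inv x \<otimes> y"] x y by (simp add: inv_mult_group)
  assume z: "z \<in> carrier \<Gamma>"
  have "inv x \<otimes> z = (inv x \<otimes> y) \<otimes> (inv y \<otimes> z)"
    using x y z by (metis inv_closed inv_solve_left m_assoc m_closed)
  then show "?d x z \<le> ?d x y + ?d y z" using len_mult[of "inv x \<otimes> y" "inv y \<otimes> z"] x y z by simp
  have "inv (z \<otimes> x) \<otimes> (z \<otimes> y) = inv x \<otimes> y"
    using x y z by (metis inv_closed inv_mult_group inv_solve_left m_assoc m_closed)
  then show "?d (z \<otimes> x) (z \<otimes> y) = ?d x y" by simp
  fix w assume w: "w \<in> carrier \<Gamma>"
  have V: "Vertex g \<in> cayley_graph \<Gamma> S" if "g \<in> carrier \<Gamma>" for g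
    using that by (auto simp: cayley_graph_def)
  \<comment> \<open>\<open>a\<close> is the distance from the base point to the point shared by both
    Gromov products; it cancels.\<close>
  have arith: "f + b \<le> c + e + k" if "(a + b - c) / 2 \<le> (a + e - f) / 2 + \<delta>" "2 * \<delta> \<le> k"
    for a b c e f k :: real using that by (simp add: field_simps)
  note dist_eq = cayley_dist_vertex[OF x y] cayley_dist_vertex[OF x w] cayley_dist_vertex[OF x z]
    cayley_dist_vertex[OF y z] cayley_dist_vertex[OF y w] cayley_dist_vertex[OF z w]
  have D: "2 * \<delta> \<le> real (nat \<lceil>2 * \<delta>\<rceil>)" by linarith
  have "min (gromov_product (cayley_dist \<Gamma> S) (Vertex w) (Vertex x) (Vertex z))
        (gromov_product (cayley_dist \<Gamma> S) (Vertex w) (Vertex y) (Vertex z)) - \<delta>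
      \<le> gromov_product (cayley_dist \<Gamma> S) (Vertex w) (Vertex x) (Vertex y)"
    using assms(2) V x y z w unfolding delta_hyperbolic_def by blast
  then consider (1) "gromov_product (cayley_dist \<Gamma> S) (Vertex w) (Vertex x) (Vertex z)
      \<le> gromov_product (cayley_dist \<Gamma> S) (Vertex w) (Vertex x) (Vertex y) + \<delta>"
    | (2) "gromov_product (cayley_dist \<Gamma> S) (Vertex w) (Vertex y) (Vertex z)
      \<le> gromov_product (cayley_dist \<Gamma> S) (Vertex w) (Vertex x) (Vertex y) + \<delta>"
    unfolding diff_le_eq min_le_iff_disj by blast
  then show "?d x y + ?d z w \<le> ?d x z + ?d y w + nat \<lceil>2 * \<delta>\<rceil>
      \<or> ?d x y + ?d z w \<le> ?d x w + ?d y z + nat \<lceil>2 * \<delta>\<rceil>"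
  proof cases
    case 1
    then have "real (?d x y) + real (?d z w) \<le> real (?d x z) + real (?d y w) + real (nat \<lceil>2 * \<delta>\<rceil>)"
      unfolding gromov_product_def dist_eq by (rule arith[OF _ D])
    then show ?thesis by (simp only: of_nat_add[symmetric] of_nat_le_iff simp_thms)
  next
    case 2
    then have "real (?d x y) + real (?d z w) \<le> real (?d x w) + real (?d y z) + real (nat \<lceil>2 * \<delta>\<rceil>)"
      using arith[OF _ D, of "real (?d y w)" "real (?d z w)" "real (?d y z)" "real (?d x w)"]
      unfolding gromov_product_def dist_eq by (simp add: add.commute)
    then show ?thesis by (simp only: of_nat_add[symmetric] of_nat_le_iff simp_thms)
  qed
next
  show "finite {x \<in> carrier \<Gamma>. len (inv \<one> \<otimes> x) \<le> r}" for r
  proof (rule finite_subset)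
    show "{x \<in> carrier \<Gamma>. len (inv \<one> \<otimes> x) \<le> r} \<subseteq> wball r"
      using in_ball_len ball_mono by fastforce
  qed (rule finite_word_ball[OF assms(1)])
qed

end

section \<open>Passage to the word metric, and the case of finite groups\<close>

lemma hyperbolic_groupE:
  assumes "hyperbolic_group \<Gamma>"
  obtains d D where "hyperbolic_word_metric \<Gamma> d D"
proof -
  from assms obtain S \<delta> where S: "group \<Gamma>" "S \<subseteq> carrier \<Gamma>" "finite S" "generate \<Gamma> S = carrier \<Gamma>"
    "Metric_space.delta_hyperbolic (cayley_graph \<Gamma> S) (cayley_dist \<Gamma> S) \<delta>"
    by (auto simp: hyperbolic_group_def)
  then interpret generated_group \<Gamma> S
    by (simp add: generated_group_def generated_group_axioms_def)
  show thesis using word_metric_hyperbolic S that by blast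
qed

text \<open>With the whole group as generating set any two vertices are joined by one edge, a loop
  if they coincide, and every point is within 1 of a vertex. So the diameter is at most 3 and all
  Gromov products lie between 0 and 3.\<close>

lemma finite_imp_hyperbolic_group:
  assumes \<Gamma>: "group \<Gamma>" and fin: "finite (carrier \<Gamma>)"
  shows "hyperbolic_group \<Gamma>"
proof -
  interpret group \<Gamma> by (rule \<Gamma>)
  let ?S = "carrier \<Gamma>" let ?X = "cayley_graph \<Gamma> ?S" let ?d = "cayley_dist \<Gamma> ?S"
  have gen: "generate \<Gamma> ?S = ?S"
    using generate_incl[of ?S] generate.incl[of _ ?S \<Gamma>] by blast
  interpret Metric_space ?X ?d by (rule Metric_space_cayley_graph[OF \<Gamma> subset_refl gen])
  have path: "?d p q \<le> l" if "cayley_path \<Gamma> ?S p q l" for p q l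
    using that cayley_path_in_graph[OF _ \<Gamma> subset_refl, of p q]
    by (auto simp: cayley_dist_def intro!: cInf_lower bdd_belowI[of _ 0])
  have vertex: "?d (Vertex g) (Vertex h) \<le> 1" if "g \<in> ?S" "h \<in> ?S" for g h
    using path[OF cayley_path_edge[OF \<Gamma> subset_refl that(1), of "inv\<^bsub>\<Gamma>\<^esub> g \<otimes>\<^bsub>\<Gamma>\<^esub> h" 0 1]] that
    by (simp add: edge_point_def m_assoc[symmetric])
  have near: "\<exists>g\<in>?S. ?d p (Vertex g) \<le> 1" if p: "p \<in> ?X" for p
  proof (cases p)
    case (Vertex g)
    then show ?thesis using p vertex by (auto simp: cayley_graph_def)
  next
    case (Interior g s t)
    then have t: "g \<in> ?S" "s \<in> ?S" "0 < t" "t < 1" using p by (auto simp: cayley_graph_def)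
    then show ?thesis
      using path[OF cayley_path_edge[OF \<Gamma> subset_refl t(1,2), of t 0]] Interior
      by (auto simp: edge_point_def intro!: bexI[of _ g])
  qed
  have diam: "?d p q \<le> 3" if p: "p \<in> ?X" and q: "q \<in> ?X" for p q
  proof -
    obtain g where g: "g \<in> ?S" "?d p (Vertex g) \<le> 1" using near[OF p] ..
    obtain h where h: "h \<in> ?S" "?d q (Vertex h) \<le> 1" using near[OF q] ..
    have V: "Vertex g \<in> ?X" "Vertex h \<in> ?X" using g h by (auto simp: cayley_graph_def)
    show ?thesis
      using triangle[OF p V(1) q] triangle[OF V q] vertex[OF g(1) h(1)] g h
        commute[of "Vertex h" q] by linarith
  qed
  have "delta_hyperbolic 3"
    unfolding delta_hyperbolic_def
  proof (intro conjI ballI)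
    fix x y z w assume c: "x \<in> ?X" "y \<in> ?X" "z \<in> ?X" "w \<in> ?X"
    have "gromov_product ?d w x z \<le> 3"
      using triangle[OF c(1,3,4)] diam[OF c(1,4)] diam[OF c(3,4)] nonneg[of x z]
      by (simp add: gromov_product_def)
    moreover have "0 \<le> gromov_product ?d w x y"
      using triangle[OF c(1,4,2)] commute[of w y] by (simp add: gromov_product_def)
    ultimately show "min (gromov_product ?d w x z) (gromov_product ?d w y z) - 3
        \<le> gromov_product ?d w x y" by linarith
  qed simp
  then show ?thesis unfolding hyperbolic_group_def using \<Gamma> fin gen by blast
qed

section \<open>Rings with a hyperbolic group of units\<close>

lemma (in group) inj_pow_of_not_torsion:
  assumes "x \<in> carrier G" "x \<notin> torsion_part G"
  shows "inj (\<lambda>n::nat. x [^] n)"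
proof (rule linorder_injI)
  fix i j :: nat assume "i < j"
  show "x [^] i \<noteq> x [^] j"
  proof
    assume "x [^] i = x [^] j"
    also have "\<dots> = x [^] i \<otimes> x [^] (j - i)"
      using assms(1) \<open>i < j\<close> by (simp add: nat_pow_mult)
    finally have "x [^] (j - i) = \<one>"
      using assms(1) by simp
    moreover have "j - i > 0" using \<open>i < j\<close> by simp
    ultimately show False using assms unfolding torsion_part_def by blast
  qed
qed

lemma finite_of_finite_fibres:
  assumes "finite (f ` A)" "\<And>b. finite {a \<in> A. f a = b}"
  shows "finite A"
proof -
  have "finite (\<Union>b\<in>f ` A. {a \<in> A. f a = b})" using assms by blast
  moreover have "A = (\<Union>b\<in>f ` A. {a \<in> A. f a = b})" by blast
  ultimately show ?thesis by simp
qed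

context ring
begin

section \<open>Sets of ring elements with vanishing products\<close>

lemma one_plus_null_pow:
  assumes v: "v \<in> carrier R" "v \<otimes> v = \<zero>"
  shows "(\<one> \<oplus> v) [^] (k::nat) = \<one> \<oplus> add_pow R k v"
proof (induction k)
  case (Suc k)
  have [simp]: "add_pow R k v \<in> carrier R" using v by simp
  have "(\<one> \<oplus> add_pow R k v) \<otimes> (\<one> \<oplus> v) = \<one> \<oplus> (add_pow R k v \<oplus> v) \<oplus> add_pow R k v \<otimes> v"
    using v by (simp add: l_distr r_distr a_ac)
  also have "add_pow R k v \<otimes> v = \<zero>" using v by (simp add: add_pow_ldistr)
  finally show ?case using v Suc by (simp add: a_ac)
qed simp

text \<open>The copy \<open>\<one> \<oplus> V\<close> of \<open>V\<close> among the units plays both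
  parts in \<open>finite_torsion_centralizer\<close>: it is the torsion set and also the infinite
  set centralising it. The inverse of \<open>\<one> \<oplus> v\<close> is
  \<open>\<one> \<oplus> \<ominus> v\<close>.\<close>

lemma finite_null_set:
  assumes hyp: "hyperbolic_group (units_of R)"
    and p: "p > 0" "add_pow R (p::nat) \<one> = \<zero>"
    and V: "V \<subseteq> carrier R" "\<And>v w. \<lbrakk>v \<in> V; w \<in> V\<rbrakk> \<Longrightarrow> v \<otimes> w = \<zero>"
  shows "finite V"
proof (rule ccontr)
  assume inf: "infinite V"
  obtain d D where "hyperbolic_word_metric (units_of R) d D"
    using hyp by (rule hyperbolic_groupE)
  then interpret U: hyperbolic_word_metric "units_of R" d D .
  define A where "A = (\<lambda>v. \<one> \<oplus> v) ` V"
  have prod: "(\<one> \<oplus> v) \<otimes> (\<one> \<oplus> w) = \<one> \<oplus> v \<oplus> w" if "v \<in> carrier R" "w \<in> carrier R" "v \<otimes> w = \<zero>" for v w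
    using that by (simp add: l_distr r_distr a_ac)
  have unit: "\<one> \<oplus> v \<in> Units R" if v: "v \<in> V" for v
  proof -
    have c: "v \<in> carrier R" "v \<otimes> v = \<zero>" using v V by auto
    have "(\<one> \<oplus> v) \<otimes> (\<one> \<oplus> \<ominus> v) = \<one>" "(\<one> \<oplus> \<ominus> v) \<otimes> (\<one> \<oplus> v) = \<one>"
      using c prod[of v "\<ominus> v"] prod[of "\<ominus> v" v]
      by (simp_all add: l_minus r_minus a_assoc r_neg l_neg)
    then show ?thesis using c unfolding Units_def by (auto intro!: bexI[of _ "\<one> \<oplus> \<ominus> v"])
  qed
  have AU: "A \<subseteq> Units R" using unit by (auto simp: A_def)
  have "inj_on (\<lambda>v. \<one> \<oplus> v) V" using V by (intro inj_onI) (metis add.l_cancel one_closed subsetD)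
  then have "infinite A" using inf by (auto simp: A_def finite_image_iff)
  moreover have "finite A"
  proof (rule U.finite_torsion_centralizer)
    show "infinite A" by fact
    show "A \<subseteq> carrier (units_of R)" using AU by (simp add: units_of_carrier)
    show "A \<subseteq> torsion_part (units_of R)"
    proof
      fix a assume a: "a \<in> A"
      then obtain v where v: "v \<in> V" "a = \<one> \<oplus> v" by (auto simp: A_def)
      then have c: "v \<in> carrier R" "v \<otimes> v = \<zero>" using V by auto
      have "add_pow R p v = (add_pow R p \<one>) \<otimes> v" using c by (simp add: add_pow_ldistr)
      then have "a [^] p = \<one>" using c p v by (simp add: one_plus_null_pow)
      then show "a \<in> torsion_part (units_of R)"
        using a AU p by (auto simp: torsion_part_def units_of_carrier units_of_one units_of_pow subset_iff)
    qed
    fix a b assume "a \<in> A" "b \<in> A"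
    then obtain v w where vw: "v \<in> V" "w \<in> V" "a = \<one> \<oplus> v" "b = \<one> \<oplus> w" by (auto simp: A_def)
    then have "v \<in> carrier R" "w \<in> carrier R" "v \<otimes> w = \<zero>" "w \<otimes> v = \<zero>" using V by auto
    then show "a \<otimes>\<^bsub>units_of R\<^esub> b = b \<otimes>\<^bsub>units_of R\<^esub> a"
      using vw by (simp add: units_of_mult prod[of v w] prod[of w v] a_assoc a_comm[of v w])
  qed
  ultimately show False by simp
qed

section \<open>Units split along an idempotent\<close>

lemma idempotent_part_mult:
  assumes c: "e \<in> carrier R" "f \<in> carrier R" "w \<in> carrier R" "x \<in> carrier R"
    and ef: "e \<otimes> e = e" "e \<otimes> f = \<zero>" "f \<otimes> e = \<zero>" "f \<otimes> f = f" and x: "x \<otimes> e = e \<otimes> x"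
  shows "(w \<otimes> e \<oplus> f) \<otimes> (x \<otimes> e \<oplus> f) = (w \<otimes> x) \<otimes> e \<oplus> f"
proof -
  have "(w \<otimes> e) \<otimes> (x \<otimes> e) = w \<otimes> (e \<otimes> x) \<otimes> e" using c by (simp add: m_assoc)
  also have "\<dots> = (w \<otimes> x) \<otimes> (e \<otimes> e)" unfolding x[symmetric] using c by (simp add: m_assoc)
  finally have 1: "(w \<otimes> e) \<otimes> (x \<otimes> e) = (w \<otimes> x) \<otimes> e" using ef by simp
  have 2: "(w \<otimes> e) \<otimes> f = \<zero>" using c ef by (simp add: m_assoc)
  have "f \<otimes> (x \<otimes> e) = (f \<otimes> e) \<otimes> x" unfolding x using c by (simp add: m_assoc)
  then have 3: "f \<otimes> (x \<otimes> e) = \<zero>" using c ef by simp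
  show ?thesis using c ef 1 2 3 by (simp add: l_distr r_distr)
qed

lemma Units_inv_commute:
  assumes "w \<in> Units R" "e \<in> carrier R" "w \<otimes> e = e \<otimes> w"
  shows "inv w \<otimes> e = e \<otimes> inv w"
proof -
  have c: "w \<in> carrier R" "inv w \<in> carrier R" using assms by auto
  have "inv w \<otimes> e = inv w \<otimes> (e \<otimes> w) \<otimes> inv w"
    using c assms by (simp add: m_assoc)
  also have "\<dots> = e \<otimes> inv w"
    unfolding assms(3)[symmetric] using c assms(1,2) by (simp add: m_assoc[symmetric])
  finally show ?thesis .
qed

text \<open>The element \<open>w \<otimes> e \<oplus> f\<close> acts as \<open>w\<close> on the part
  cut out by \<open>e\<close> and as the identity on the other part. The inverse of \<open>w\<close>
  also commutes with \<open>e\<close>, so it yields the inverse in the same way.\<close>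

lemma idempotent_part_unit:
  assumes c: "e \<in> carrier R" "f \<in> carrier R" "w \<in> Units R" and sum: "e \<oplus> f = \<one>"
    and ef: "e \<otimes> e = e" "e \<otimes> f = \<zero>" "f \<otimes> e = \<zero>" "f \<otimes> f = f" and w: "w \<otimes> e = e \<otimes> w"
  shows "w \<otimes> e \<oplus> f \<in> Units R"
proof -
  have c': "w \<in> carrier R" "inv w \<in> carrier R" using c by auto
  note wi = Units_inv_commute[OF c(3,1) w]
  have "(w \<otimes> e \<oplus> f) \<otimes> (inv w \<otimes> e \<oplus> f) = \<one>" "(inv w \<otimes> e \<oplus> f) \<otimes> (w \<otimes> e \<oplus> f) = \<one>"
    using idempotent_part_mult[OF c(1,2) c' ef wi] idempotent_part_mult[OF c(1,2) c'(2,1) ef w] c sum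
    by simp_all
  then show ?thesis using c c' unfolding Units_def by (auto intro!: bexI[of _ "inv w \<otimes> e \<oplus> f"])
qed

text \<open>Through \<open>\<phi>\<close> and \<open>\<psi>\<close> two copies of \<open>W\<close>
  act independently on the parts cut out by \<open>e\<close> and \<open>f\<close>. Finite fibres are
  assumed in place of injectivity, because distinct elements of \<open>W\<close> can agree after
  multiplication by \<open>e\<close>, as the identity and \<open>\<gamma>\<close> do in
  \<open>finite_of_torsion\<close>.\<close>

lemma finite_units_commuting_with_idempotent:
  assumes hyp: "hyperbolic_group (units_of R)"
    and c: "e \<in> carrier R" "f \<in> carrier R" and sum: "e \<oplus> f = \<one>"
    and ef: "e \<otimes> f = \<zero>" "f \<otimes> e = \<zero>"
    and W: "W \<subseteq> Units R" "\<one> \<in> W" "\<And>v w. \<lbrakk>v \<in> W; w \<in> W\<rbrakk> \<Longrightarrow> v \<otimes> w \<in> W"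
    and comm: "\<And>w. w \<in> W \<Longrightarrow> w \<otimes> e = e \<otimes> w"
    and fibres: "\<And>b. finite {w \<in> W. w \<otimes> e = b}" "\<And>b. finite {w \<in> W. w \<otimes> f = b}"
  shows "finite W"
proof (rule ccontr)
  assume inf: "infinite W"
  obtain d D where "hyperbolic_word_metric (units_of R) d D"
    using hyp by (rule hyperbolic_groupE)
  then interpret U: hyperbolic_word_metric "units_of R" d D .
  have Wc: "w \<in> carrier R" "w \<in> Units R" if "w \<in> W" for w using that W by auto
  have ee: "e \<otimes> e = e" "f \<otimes> f = f"
    using r_distr[of e f e] r_distr[of e f f] c sum ef by simp_all
  have f_eq: "f = \<one> \<ominus> e" using sum c by (metis add.m_comm add.inv_solve_right' minus_eq one_closed)
  have commf: "w \<otimes> f = f \<otimes> w" if "w \<in> W" for w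
    using comm[OF that] Wc[OF that] c
    by (simp add: f_eq minus_eq l_distr r_distr r_minus l_minus)
  define \<phi> where "\<phi> w = w \<otimes> e \<oplus> f" for w
  define \<psi> where "\<psi> w = w \<otimes> f \<oplus> e" for w
  have sum': "f \<oplus> e = \<one>" using sum c by (simp add: a_comm)
  have \<phi>U: "\<phi> w \<in> Units R" if "w \<in> W" for w
    unfolding \<phi>_def using idempotent_part_unit[OF c Wc(2)[OF that] sum ee(1) ef ee(2) comm[OF that]] .
  have \<psi>U: "\<psi> w \<in> Units R" if "w \<in> W" for w
    unfolding \<psi>_def
    using idempotent_part_unit[OF c(2,1) Wc(2)[OF that] sum' ee(2) ef(2,1) ee(1) commf[OF that]] .
  have \<phi>_mult: "\<phi> v \<otimes> \<phi> w = \<phi> (v \<otimes> w)" if "v \<in> W" "w \<in> W" for v w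
    unfolding \<phi>_def
    using idempotent_part_mult[OF c Wc(1)[OF that(1)] Wc(1)[OF that(2)] ee(1) ef ee(2) comm[OF that(2)]] .
  have \<psi>_mult: "\<psi> v \<otimes> \<psi> w = \<psi> (v \<otimes> w)" if "v \<in> W" "w \<in> W" for v w
    unfolding \<psi>_def
    using idempotent_part_mult[OF c(2,1) Wc(1)[OF that(1)] Wc(1)[OF that(2)] ee(2) ef(2,1) ee(1) commf[OF that(2)]] .
  \<comment> \<open>Both orders give the same sum, so \<open>\<phi> v\<close> and
    \<open>\<psi> w\<close> commute even when \<open>v\<close> and \<open>w\<close> do not.\<close>
  have cross: "\<phi> v \<otimes> \<psi> w = v \<otimes> e \<oplus> w \<otimes> f" "\<psi> w \<otimes> \<phi> v = v \<otimes> e \<oplus> w \<otimes> f"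
    if vw: "v \<in> W" "w \<in> W" for v w
  proof -
    note vc = Wc(1)[OF vw(1)] and wc = Wc(1)[OF vw(2)]
    have "(v \<otimes> e) \<otimes> (w \<otimes> f) = v \<otimes> (e \<otimes> f) \<otimes> w"
      unfolding commf[OF vw(2)] using vc wc c by (simp add: m_assoc)
    moreover have "(w \<otimes> f) \<otimes> (v \<otimes> e) = w \<otimes> (f \<otimes> e) \<otimes> v"
      unfolding comm[OF vw(1)] using vc wc c by (simp add: m_assoc)
    moreover have "f \<otimes> (w \<otimes> f) = w \<otimes> f" "e \<otimes> (v \<otimes> e) = v \<otimes> e"
      using comm[OF vw(1)] commf[OF vw(2)] vc wc c ee by (simp_all add: m_assoc[symmetric]; simp add: m_assoc)+
    ultimately show "\<phi> v \<otimes> \<psi> w = v \<otimes> e \<oplus> w \<otimes> f" "\<psi> w \<otimes> \<phi> v = v \<otimes> e \<oplus> w \<otimes> f"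
      using vc wc c ef ee by (simp_all add: \<phi>_def \<psi>_def l_distr r_distr m_assoc a_comm)
  qed
  have Wpow: "w [^] (k::nat) \<in> W" if "w \<in> W" for w k
    using that W by (induction k) auto
  have one: "\<phi> \<one> = \<one>" "\<psi> \<one> = \<one>" using c sum sum' by (simp_all add: \<phi>_def \<psi>_def)
  have \<phi>_pow: "\<phi> w [^] (k::nat) = \<phi> (w [^] k)" if "w \<in> W" for w k
    by (induction k) (simp_all add: one \<phi>_mult Wpow that)
  have \<psi>_pow: "\<psi> w [^] (k::nat) = \<psi> (w [^] k)" if "w \<in> W" for w k
    by (induction k) (simp_all add: one \<psi>_mult Wpow that)
  have inf_image: "infinite (h ` W)" if "\<And>b. finite {w \<in> W. h w = b}" for h :: "'a \<Rightarrow> 'a"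
    using finite_of_finite_fibres[OF _ that] inf by blast
  show False
  proof (cases "W \<subseteq> torsion_part (units_of R)")
    case True
    have "infinite (\<phi> ` W)"
    proof (rule inf_image)
      fix b show "finite {w \<in> W. \<phi> w = b}"
      proof (rule finite_subset[OF _ fibres(1)[of "b \<ominus> f"]])
        show "{w \<in> W. \<phi> w = b} \<subseteq> {w \<in> W. w \<otimes> e = b \<ominus> f}"
          using Wc c by (auto simp: \<phi>_def minus_eq a_assoc r_neg)
      qed
    qed
    moreover have "infinite (\<psi> ` W)"
    proof (rule inf_image)
      fix b show "finite {w \<in> W. \<psi> w = b}"
      proof (rule finite_subset[OF _ fibres(2)[of "b \<ominus> e"]])
        show "{w \<in> W. \<psi> w = b} \<subseteq> {w \<in> W. w \<otimes> f = b \<ominus> e}"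
          using Wc c by (auto simp: \<psi>_def minus_eq a_assoc r_neg)
      qed
    qed
    moreover have "finite (\<phi> ` W)" if "infinite (\<psi> ` W)"
    proof (rule U.finite_torsion_centralizer[OF that])
      show "\<psi> ` W \<subseteq> carrier (units_of R)" using \<psi>U by (auto simp: units_of_carrier)
      show "\<phi> ` W \<subseteq> torsion_part (units_of R)"
      proof
        fix x assume "x \<in> \<phi> ` W"
        then obtain w where w: "w \<in> W" "x = \<phi> w" by auto
        then obtain k :: nat where "k > 0" "w [^] k = \<one>"
          using True Wc(2)[OF w(1)] by (auto simp: torsion_part_def units_of_one units_of_pow)
        then show "x \<in> torsion_part (units_of R)"
          using w \<phi>U[OF w(1)] \<phi>_pow[OF w(1), of k] one
          by (auto simp: torsion_part_def units_of_one units_of_pow units_of_carrier)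
      qed
      show "a \<otimes>\<^bsub>units_of R\<^esub> b = b \<otimes>\<^bsub>units_of R\<^esub> a" if "a \<in> \<phi> ` W" "b \<in> \<psi> ` W" for a b
        using that cross by (auto simp: units_of_mult)
    qed
    ultimately show False by blast
  next
    case False
    then obtain w where w: "w \<in> W" "w \<notin> torsion_part (units_of R)" by auto
    note wU = Wc(2)[OF w(1)]
    have "inj (\<lambda>n::nat. w [^]\<^bsub>units_of R\<^esub> n)"
      using w wU by (intro U.inj_pow_of_not_torsion) (auto simp: units_of_carrier)
    then have inj: "inj (\<lambda>n::nat. w [^] n)" using wU by (simp add: units_of_pow)
    \<comment> \<open>If two powers agreed on \<open>h\<close>, some \<open>w [^] k\<close> with
      \<open>k > 0\<close> would fix \<open>h\<close>, and the infinitely many powers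
      \<open>w [^] (k * m)\<close> would lie in a single fibre.\<close>
    have aux: "inj (\<lambda>n::nat. w [^] n \<otimes> h)"
      if h: "h \<in> carrier R" "finite {v \<in> W. v \<otimes> h = h}" for h
    proof (rule linorder_injI)
      fix i j :: nat assume ij: "i < j"
      show "w [^] i \<otimes> h \<noteq> w [^] j \<otimes> h"
      proof
        assume eq: "w [^] i \<otimes> h = w [^] j \<otimes> h"
        define k where "k = j - i"
        have k: "k > 0" "j = i + k" using ij by (auto simp: k_def)
        have wi: "w [^] i \<in> Units R" using Wpow[OF w(1)] Wc by auto
        have "w [^] i \<otimes> h = w [^] i \<otimes> (w [^] k \<otimes> h)"
          using eq k Units_closed[OF wU] h by (simp add: nat_pow_mult m_assoc[symmetric])
        then have wk: "w [^] k \<otimes> h = h" using wi Units_closed[OF wU] h by (metis Units_l_cancel m_closed nat_pow_closed)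
        have "w [^] (k * m) \<otimes> h = h" for m
        proof (induction m)
          case (Suc m)
          have "w [^] (k * Suc m) = w [^] k \<otimes> w [^] (k * m)"
            using Units_closed[OF wU] by (simp add: nat_pow_mult)
          then show ?case using Suc wk Units_closed[OF wU] h by (simp add: m_assoc)
        qed (use h in simp)
        then have "range (\<lambda>m. w [^] (k * m)) \<subseteq> {v \<in> W. v \<otimes> h = h}"
          using Wpow[OF w(1)] by auto
        moreover have "inj (\<lambda>m. w [^] (k * m))"
          using injD[OF inj] k(1) by (intro injI) (metis mult_cancel1 not_gr0)
        ultimately show False
          using h(2) finite_subset range_inj_infinite by blast
      qed
    qed
    have inje: "inj (\<lambda>n::nat. w [^] n \<otimes> e)" and injf: "inj (\<lambda>n::nat. w [^] n \<otimes> f)"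
      using aux fibres c by blast+
    have pc: "w [^] (i::nat) \<in> carrier R" for i using wU by auto
    show False
    proof (rule U.no_rank_two_abelian[of "\<phi> w" "\<psi> w"])
      show "inj (\<lambda>(i::nat, j::nat). \<phi> w [^]\<^bsub>units_of R\<^esub> i \<otimes>\<^bsub>units_of R\<^esub> \<psi> w [^]\<^bsub>units_of R\<^esub> j)"
      proof (rule injI, clarify)
        fix i j i' j' :: nat
        assume "\<phi> w [^]\<^bsub>units_of R\<^esub> i \<otimes>\<^bsub>units_of R\<^esub> \<psi> w [^]\<^bsub>units_of R\<^esub> j
          = \<phi> w [^]\<^bsub>units_of R\<^esub> i' \<otimes>\<^bsub>units_of R\<^esub> \<psi> w [^]\<^bsub>units_of R\<^esub> j'"
        then have eq: "w [^] i \<otimes> e \<oplus> w [^] j \<otimes> f = w [^] i' \<otimes> e \<oplus> w [^] j' \<otimes> f"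
          using \<phi>U[OF w(1)] \<psi>U[OF w(1)] w(1)
          by (simp add: units_of_pow units_of_mult \<phi>_pow \<psi>_pow cross Wpow)
        \<comment> \<open>Multiplication by \<open>e\<close> and by \<open>f\<close> separates the
          two exponents.\<close>
        have "(w [^] i \<otimes> e \<oplus> w [^] j \<otimes> f) \<otimes> e = w [^] i \<otimes> e"
          "(w [^] i \<otimes> e \<oplus> w [^] j \<otimes> f) \<otimes> f = w [^] j \<otimes> f" for i j :: nat
          using pc c ef ee by (simp_all add: l_distr m_assoc)
        then have "w [^] i \<otimes> e = w [^] i' \<otimes> e" "w [^] j \<otimes> f = w [^] j' \<otimes> f"
          using eq by metis+
        then show "i = i' \<and> j = j'" using inje injf by (auto simp: inj_def)
      qed
    qed (use \<phi>U \<psi>U w cross in \<open>auto simp: units_of_carrier units_of_mult\<close>)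
  qed
qed

section \<open>Geometric sums\<close>

lemma power_sum_Suc:
  "\<gamma> \<in> carrier R \<Longrightarrow> (\<Oplus>i\<in>{..<Suc n}. \<gamma> [^] i) = \<gamma> [^] n \<oplus> (\<Oplus>i\<in>{..<n}. \<gamma> [^] i)"
  unfolding lessThan_Suc by (rule finsum_insert) auto

lemma power_sum_closed: "\<gamma> \<in> carrier R \<Longrightarrow> (\<Oplus>i\<in>{..<n::nat}. \<gamma> [^] i) \<in> carrier R"
  by (intro finsum_closed) auto

text \<open>The telescoping identity for \<open>\<gamma> - 1\<close> times the sum, on either side,
  rearranged so that no subtraction occurs.\<close>

lemma power_sum_shift:
  assumes \<gamma>: "\<gamma> \<in> carrier R"
  shows "\<gamma> \<otimes> (\<Oplus>i\<in>{..<n::nat}. \<gamma> [^] i) \<oplus> \<one> = (\<Oplus>i\<in>{..<n}. \<gamma> [^] i) \<oplus> \<gamma> [^] n"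
    and "(\<Oplus>i\<in>{..<n}. \<gamma> [^] i) \<otimes> \<gamma> \<oplus> \<one> = (\<Oplus>i\<in>{..<n}. \<gamma> [^] i) \<oplus> \<gamma> [^] n"
proof (induction n)
  case (Suc n)
  note [simp] = power_sum_closed[OF \<gamma>]
  {
    case 1
    have "\<gamma> \<otimes> (\<Oplus>i\<in>{..<Suc n}. \<gamma> [^] i) \<oplus> \<one> = \<gamma> \<otimes> \<gamma> [^] n \<oplus> (\<gamma> \<otimes> (\<Oplus>i\<in>{..<n}. \<gamma> [^] i) \<oplus> \<one>)"
      using \<gamma> by (simp add: power_sum_Suc r_distr a_assoc del: nat_pow_Suc)
    then show ?case
      unfolding Suc.IH(1) power_sum_Suc[OF \<gamma>] nat_pow_Suc2[OF \<gamma>] using \<gamma> by (simp add: a_ac del: nat_pow_Suc)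
  next
    case 2
    have "(\<Oplus>i\<in>{..<Suc n}. \<gamma> [^] i) \<otimes> \<gamma> \<oplus> \<one> = \<gamma> [^] n \<otimes> \<gamma> \<oplus> ((\<Oplus>i\<in>{..<n}. \<gamma> [^] i) \<otimes> \<gamma> \<oplus> \<one>)"
      using \<gamma> by (simp add: power_sum_Suc l_distr a_assoc)
    then show ?case
      unfolding Suc.IH(2) power_sum_Suc[OF \<gamma>] using \<gamma> by (simp add: a_ac)
  }
qed (use \<gamma> in auto)

lemma power_sum_fixed:
  assumes \<gamma>: "\<gamma> \<in> carrier R" and n: "\<gamma> [^] (n::nat) = \<one>"
  shows "\<gamma> \<otimes> (\<Oplus>i\<in>{..<n}. \<gamma> [^] i) = (\<Oplus>i\<in>{..<n}. \<gamma> [^] i)"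
    and "(\<Oplus>i\<in>{..<n}. \<gamma> [^] i) \<otimes> \<gamma> = (\<Oplus>i\<in>{..<n}. \<gamma> [^] i)"
  using power_sum_shift[OF \<gamma>, of n] \<gamma> power_sum_closed[OF \<gamma>] unfolding n by auto

text \<open>All powers of \<open>\<gamma>\<close> fix \<open>a\<close> as well, so the sum acts on
  \<open>a\<close> as the integer \<open>n\<close>. If \<open>\<gamma> [^] n = \<one>\<close>, the
  sum itself is such an \<open>a\<close>, and its square is \<open>n\<close> times itself.\<close>

lemma power_sum_absorb:
  assumes \<gamma>: "\<gamma> \<in> carrier R" and a: "a \<in> carrier R"
  shows "\<gamma> \<otimes> a = a \<Longrightarrow> (\<Oplus>i\<in>{..<n}. \<gamma> [^] i) \<otimes> a = add_pow R (n::nat) a"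
    and "a \<otimes> \<gamma> = a \<Longrightarrow> a \<otimes> (\<Oplus>i\<in>{..<n}. \<gamma> [^] i) = add_pow R n a"
proof -
  note [simp] = power_sum_closed[OF \<gamma>]
  assume f: "\<gamma> \<otimes> a = a"
  have "\<gamma> [^] i \<otimes> a = a" for i :: nat
    by (induction i) (use \<gamma> a f in \<open>simp_all add: m_assoc\<close>)
  then show "(\<Oplus>i\<in>{..<n}. \<gamma> [^] i) \<otimes> a = add_pow R n a"
    using \<gamma> a by (induction n) (simp_all add: power_sum_Suc l_distr a_comm)
next
  note [simp] = power_sum_closed[OF \<gamma>]
  assume f: "a \<otimes> \<gamma> = a"
  have "a \<otimes> \<gamma> [^] i = a" for i :: nat
    by (induction i) (use \<gamma> a f in \<open>simp_all add: m_assoc[symmetric]\<close>)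
  then show "a \<otimes> (\<Oplus>i\<in>{..<n}. \<gamma> [^] i) = add_pow R n a"
    using \<gamma> a by (induction n) (simp_all add: power_sum_Suc r_distr a_comm)
qed

end

section \<open>Group algebras\<close>

text \<open>The element \<open>k h\<close>. Scalars (\<open>h = \<one>\<close>) and group elements
  (\<open>k = \<one>\<close>) thereby become ring elements, so that both can be treated as
  units.\<close>

definition monomial ::
    "('k, 'm) ring_scheme \<Rightarrow> ('g, 'n) monoid_scheme \<Rightarrow> 'k \<Rightarrow> 'g \<Rightarrow> 'g \<Rightarrow> 'k" where
  "monomial K G k h = (\<lambda>x\<in>carrier G. if x = h then k else \<zero>\<^bsub>K\<^esub>)"

locale group_algebra_over_field = K: field K + G: group G
  for K :: "('k, 'm) ring_scheme" (structure) and G :: "('g, 'n) monoid_scheme" (structure)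
begin

abbreviation "A \<equiv> group_algebra K G"
abbreviation "mono_el \<equiv> monomial K G"
abbreviation "\<iota> \<equiv> monomial K G \<one>\<^bsub>K\<^esub>"

sublocale A: ring A
  using ring_group_algebra K.field_axioms G.group_axioms .

lemmas A_D = group_algebra_carrier_D[OF K.field_axioms G.group_axioms]
lemmas A_eqI = group_algebra_eqI[OF K.field_axioms G.group_axioms]
lemmas A_ext = group_algebra_extensional[OF K.field_axioms G.group_axioms]

lemma monomial_closed [simp]:
  "\<lbrakk>k \<in> carrier K; h \<in> carrier G\<rbrakk> \<Longrightarrow> mono_el k h \<in> carrier A"
  by (rule group_algebra_carrier_I[OF K.field_axioms G.group_axioms, where A = "{h}"])
    (auto simp: monomial_def)

lemma monomial_mult_left:
  assumes k: "k \<in> carrier K" and h: "h \<in> carrier G" and a: "a \<in> carrier A" and x: "x \<in> carrier G"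
  shows "(mono_el k h \<otimes>\<^bsub>A\<^esub> a) x = k \<otimes>\<^bsub>K\<^esub> a (inv\<^bsub>G\<^esub> h \<otimes>\<^bsub>G\<^esub> x)"
proof -
  have "(mono_el k h \<otimes>\<^bsub>A\<^esub> a) x = (\<Oplus>\<^bsub>K\<^esub>y\<in>{h}. mono_el k h y \<otimes>\<^bsub>K\<^esub> a (inv\<^bsub>G\<^esub> y \<otimes>\<^bsub>G\<^esub> x))"
    using assms by (intro group_algebra_mult_eq[OF K.field_axioms G.group_axioms] monomial_closed)
      (auto simp: supp_def monomial_def)
  also have "\<dots> = k \<otimes>\<^bsub>K\<^esub> a (inv\<^bsub>G\<^esub> h \<otimes>\<^bsub>G\<^esub> x)"
    using assms A_D(1)[OF a] by (simp add: monomial_def)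
  finally show ?thesis .
qed

lemma monomial_mult_right:
  assumes k: "k \<in> carrier K" and h: "h \<in> carrier G" and a: "a \<in> carrier A" and x: "x \<in> carrier G"
  shows "(a \<otimes>\<^bsub>A\<^esub> mono_el k h) x = a (x \<otimes>\<^bsub>G\<^esub> inv\<^bsub>G\<^esub> h) \<otimes>\<^bsub>K\<^esub> k"
proof -
  \<comment> \<open>Only the index \<open>?y\<close> contributes to the convolution; it is inserted
    into the range of summation because \<open>a ?y\<close> may vanish.\<close>
  let ?y = "x \<otimes>\<^bsub>G\<^esub> inv\<^bsub>G\<^esub> h"
  have S: "insert ?y (supp K G a) \<subseteq> carrier G" using x h by (auto simp: supp_def)
  have "(a \<otimes>\<^bsub>A\<^esub> mono_el k h) x
      = (\<Oplus>\<^bsub>K\<^esub>y\<in>insert ?y (supp K G a). a y \<otimes>\<^bsub>K\<^esub> mono_el k h (inv\<^bsub>G\<^esub> y \<otimes>\<^bsub>G\<^esub> x))"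
    using assms S A_D(2)[OF a]
    by (intro group_algebra_mult_eq[OF K.field_axioms G.group_axioms] monomial_closed) auto
  also have "\<dots> = (\<Oplus>\<^bsub>K\<^esub>y\<in>insert ?y (supp K G a). if ?y = y then a y \<otimes>\<^bsub>K\<^esub> k else \<zero>\<^bsub>K\<^esub>)"
  proof (rule K.add.finprod_cong')
    fix y assume "y \<in> insert ?y (supp K G a)"
    then have y: "y \<in> carrier G" using S by blast
    have "inv\<^bsub>G\<^esub> y \<otimes>\<^bsub>G\<^esub> x = h \<longleftrightarrow> ?y = y"
      using x y h by (metis G.inv_solve_left G.inv_solve_right)
    then show "a y \<otimes>\<^bsub>K\<^esub> mono_el k h (inv\<^bsub>G\<^esub> y \<otimes>\<^bsub>G\<^esub> x) = (if ?y = y then a y \<otimes>\<^bsub>K\<^esub> k else \<zero>\<^bsub>K\<^esub>)"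
      using x y A_D(1)[OF a y] by (auto simp: monomial_def)
  qed (use S k A_D(1)[OF a] in auto)
  also have "\<dots> = a ?y \<otimes>\<^bsub>K\<^esub> k"
    using A_D(2)[OF a] S k A_D(1)[OF a] by (intro K.finsum_singleton) auto
  finally show ?thesis .
qed

lemma monomial_mult:
  assumes "k \<in> carrier K" "l \<in> carrier K" "g \<in> carrier G" "h \<in> carrier G"
  shows "mono_el k g \<otimes>\<^bsub>A\<^esub> mono_el l h = mono_el (k \<otimes>\<^bsub>K\<^esub> l) (g \<otimes>\<^bsub>G\<^esub> h)"
proof (rule A_eqI)
  fix x assume x: "x \<in> carrier G"
  have "inv\<^bsub>G\<^esub> g \<otimes>\<^bsub>G\<^esub> x = h \<longleftrightarrow> x = g \<otimes>\<^bsub>G\<^esub> h"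
    using x assms by (metis G.inv_solve_left)
  then show "(mono_el k g \<otimes>\<^bsub>A\<^esub> mono_el l h) x = mono_el (k \<otimes>\<^bsub>K\<^esub> l) (g \<otimes>\<^bsub>G\<^esub> h) x"
    using x assms by (simp add: monomial_mult_left) (auto simp: monomial_def)
qed (auto simp: A_ext monomial_def)

lemma monomial_one: "\<iota> \<one>\<^bsub>G\<^esub> = \<one>\<^bsub>A\<^esub>"
  by (simp add: monomial_def group_algebra_def)

lemma scalar_commutes:
  assumes "k \<in> carrier K" "a \<in> carrier A"
  shows "mono_el k \<one>\<^bsub>G\<^esub> \<otimes>\<^bsub>A\<^esub> a = a \<otimes>\<^bsub>A\<^esub> mono_el k \<one>\<^bsub>G\<^esub>"
  using assms A_D(1)[OF assms(2)]
  by (intro A_eqI) (auto simp: A_ext monomial_mult_left monomial_mult_right K.m_comm)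

lemma add_pow_one: "add_pow A (n::nat) \<one>\<^bsub>A\<^esub> = mono_el (add_pow K n \<one>\<^bsub>K\<^esub>) \<one>\<^bsub>G\<^esub>"
proof (induction n)
  case 0
  then show ?case
    unfolding A.add.nat_pow_0 K.add.nat_pow_0
    by (simp add: monomial_def group_algebra_def restrict_def cong: if_cong)
next
  case (Suc n)
  then show ?case
    unfolding A.add.nat_pow_Suc K.add.nat_pow_Suc Suc
    by (simp add: monomial_def group_algebra_def restrict_def cong: if_cong) auto
qed

lemma add_pow_eq_scalar:
  assumes "a \<in> carrier A"
  shows "add_pow A (n::nat) a = mono_el (add_pow K n \<one>\<^bsub>K\<^esub>) \<one>\<^bsub>G\<^esub> \<otimes>\<^bsub>A\<^esub> a"
  using A.add_pow_ldistr[of "\<one>\<^bsub>A\<^esub>" a n] assms by (simp add: add_pow_one)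

section \<open>Coefficients, injectivity and finite fibres\<close>

lemma nonzero_coefficient:
  assumes "a \<in> carrier A" "a \<noteq> \<zero>\<^bsub>A\<^esub>"
  obtains x where "x \<in> carrier G" "a x \<noteq> \<zero>\<^bsub>K\<^esub>"
proof -
  have "\<exists>x\<in>carrier G. a x \<noteq> \<zero>\<^bsub>K\<^esub>"
  proof (rule ccontr)
    assume "\<not> ?thesis"
    then have "a = \<zero>\<^bsub>A\<^esub>"
      using A_D(3)[OF assms(1)] by (intro A_eqI) (auto simp: A_ext, simp add: group_algebra_def)
    with assms(2) show False ..
  qed
  then show thesis using that by blast
qed

lemma scalar_mult_inj:
  assumes a: "a \<in> carrier A" "a \<noteq> \<zero>\<^bsub>A\<^esub>"
  shows "inj_on (\<lambda>k. mono_el k \<one>\<^bsub>G\<^esub> \<otimes>\<^bsub>A\<^esub> a) (carrier K)"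
proof (rule inj_onI)
  fix k l assume kl: "k \<in> carrier K" "l \<in> carrier K"
    and eq: "mono_el k \<one>\<^bsub>G\<^esub> \<otimes>\<^bsub>A\<^esub> a = mono_el l \<one>\<^bsub>G\<^esub> \<otimes>\<^bsub>A\<^esub> a"
  obtain x where x: "x \<in> carrier G" "a x \<noteq> \<zero>\<^bsub>K\<^esub>" using nonzero_coefficient[OF a] .
  have "k \<otimes>\<^bsub>K\<^esub> a x = l \<otimes>\<^bsub>K\<^esub> a x"
    using fun_cong[OF eq, of x] x kl a by (simp add: monomial_mult_left)
  then show "k = l" using x kl A_D(1)[OF a(1) x(1)] by (simp add: K.m_rcancel)
qed

lemma monomial_inj: "inj_on \<iota> (carrier G)"
proof (rule inj_onI)
  fix g h assume gh: "g \<in> carrier G" "h \<in> carrier G" and eq: "\<iota> g = \<iota> h"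
  show "g = h" using fun_cong[OF eq, of g] gh by (simp add: monomial_def split: if_splits)
qed

lemma monomial_unit:
  assumes "k \<in> carrier K" "k \<noteq> \<zero>\<^bsub>K\<^esub>" "h \<in> carrier G"
  shows "mono_el k h \<in> Units A"
proof -
  have k: "inv\<^bsub>K\<^esub> k \<in> carrier K" "k \<otimes>\<^bsub>K\<^esub> inv\<^bsub>K\<^esub> k = \<one>\<^bsub>K\<^esub>" "inv\<^bsub>K\<^esub> k \<otimes>\<^bsub>K\<^esub> k = \<one>\<^bsub>K\<^esub>"
    using assms K.field_Units by auto
  then show ?thesis
    using assms unfolding Units_def
    by (auto simp: monomial_mult monomial_one intro!: bexI[of _ "mono_el (inv\<^bsub>K\<^esub> k) (inv\<^bsub>G\<^esub> h)"])
qed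

lemma monomial_pow: "h \<in> carrier G \<Longrightarrow> \<iota> h [^]\<^bsub>A\<^esub> (n::nat) = \<iota> (h [^]\<^bsub>G\<^esub> n)"
  by (induction n) (auto simp: monomial_one monomial_mult)

text \<open>If \<open>v\<close> has a nonzero coefficient at \<open>x\<close>, then \<open>x\<close>
  is a product \<open>y h z\<close> with \<open>y\<close> in the support of \<open>a\<close> and
  \<open>z\<close> in that of \<open>b\<close>. Hence \<open>h\<close> is one of finitely many
  elements determined by \<open>x\<close>, \<open>y\<close> and \<open>z\<close>.\<close>

lemma finite_sandwich_fibre:
  assumes a: "a \<in> carrier A" and b: "b \<in> carrier A" and v: "v \<in> carrier A" "v \<noteq> \<zero>\<^bsub>A\<^esub>"
  shows "finite {h \<in> carrier G. a \<otimes>\<^bsub>A\<^esub> (\<iota> h \<otimes>\<^bsub>A\<^esub> b) = v}"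
proof -
  obtain x where x: "x \<in> carrier G" "v x \<noteq> \<zero>\<^bsub>K\<^esub>" using nonzero_coefficient[OF v] .
  let ?F = "(\<lambda>(y, z). inv\<^bsub>G\<^esub> y \<otimes>\<^bsub>G\<^esub> x \<otimes>\<^bsub>G\<^esub> inv\<^bsub>G\<^esub> z) ` (supp K G a \<times> supp K G b)"
  have "{h \<in> carrier G. a \<otimes>\<^bsub>A\<^esub> (\<iota> h \<otimes>\<^bsub>A\<^esub> b) = v} \<subseteq> ?F"
  proof clarify
    fix h assume h: "h \<in> carrier G" and eq: "v = a \<otimes>\<^bsub>A\<^esub> (\<iota> h \<otimes>\<^bsub>A\<^esub> b)"
    have hb: "\<iota> h \<otimes>\<^bsub>A\<^esub> b \<in> carrier A" using h b by simp
    have "x \<in> (\<lambda>(y, z). y \<otimes>\<^bsub>G\<^esub> z) ` (supp K G a \<times> supp K G (\<iota> h \<otimes>\<^bsub>A\<^esub> b))"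
      using group_algebra_mult_eq_0[OF K.field_axioms G.group_axioms a hb x(1)] x eq by auto
    then obtain y u where yu: "y \<in> supp K G a" "u \<in> supp K G (\<iota> h \<otimes>\<^bsub>A\<^esub> b)" "x = y \<otimes>\<^bsub>G\<^esub> u"
      by auto
    then have c: "y \<in> carrier G" "u \<in> carrier G" by (auto simp: supp_def)
    have "b (inv\<^bsub>G\<^esub> h \<otimes>\<^bsub>G\<^esub> u) \<noteq> \<zero>\<^bsub>K\<^esub>"
      using yu(2) c h b A_D(1)[OF b] by (auto simp: supp_def monomial_mult_left)
    then have "inv\<^bsub>G\<^esub> h \<otimes>\<^bsub>G\<^esub> u \<in> supp K G b" using c h by (simp add: supp_def)
    moreover have "h = inv\<^bsub>G\<^esub> y \<otimes>\<^bsub>G\<^esub> x \<otimes>\<^bsub>G\<^esub> inv\<^bsub>G\<^esub> (inv\<^bsub>G\<^esub> h \<otimes>\<^bsub>G\<^esub> u)"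
    proof -
      have "inv\<^bsub>G\<^esub> y \<otimes>\<^bsub>G\<^esub> x = u" using yu(3) c by (simp add: G.m_assoc[symmetric])
      moreover have "u \<otimes>\<^bsub>G\<^esub> (inv\<^bsub>G\<^esub> u \<otimes>\<^bsub>G\<^esub> h) = h" using c h by (simp add: G.m_assoc[symmetric])
      ultimately show ?thesis using c h by (simp add: G.inv_mult_group)
    qed
    ultimately show "h \<in> ?F" using yu(1) by force
  qed
  moreover have "finite ?F" using A_D(2)[OF a] A_D(2)[OF b] by simp
  ultimately show ?thesis by (rule finite_subset)
qed


lemma scalar_zero: "mono_el \<zero>\<^bsub>K\<^esub> \<one>\<^bsub>G\<^esub> = \<zero>\<^bsub>A\<^esub>"
  by (simp add: monomial_def group_algebra_def restrict_def cong: if_cong)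

text \<open>Among the powers of \<open>g\<close> below its order only the zeroth is the identity.
  This coefficient is what shows that the sum is nonzero.\<close>

lemma power_sum_at_one:
  assumes g: "g \<in> carrier G"
  shows "\<lbrakk>n > 0; \<And>i. \<lbrakk>0 < i; i < n\<rbrakk> \<Longrightarrow> g [^]\<^bsub>G\<^esub> i \<noteq> \<one>\<^bsub>G\<^esub>\<rbrakk>
    \<Longrightarrow> (\<Oplus>\<^bsub>A\<^esub>i\<in>{..<n::nat}. \<iota> g [^]\<^bsub>A\<^esub> i) \<one>\<^bsub>G\<^esub> = \<one>\<^bsub>K\<^esub>"
proof (induction n)
  case (Suc n)
  have \<gamma>: "\<iota> g \<in> carrier A" using g by simp
  have "(\<Oplus>\<^bsub>A\<^esub>i\<in>{..<Suc n}. \<iota> g [^]\<^bsub>A\<^esub> i) \<one>\<^bsub>G\<^esub>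
      = \<iota> (g [^]\<^bsub>G\<^esub> n) \<one>\<^bsub>G\<^esub> \<oplus>\<^bsub>K\<^esub> (\<Oplus>\<^bsub>A\<^esub>i\<in>{..<n}. \<iota> g [^]\<^bsub>A\<^esub> i) \<one>\<^bsub>G\<^esub>"
    unfolding A.power_sum_Suc[OF \<gamma>] monomial_pow[OF g, symmetric]
    by (simp add: group_algebra_add_eq[OF K.field_axioms G.group_axioms])
  also have "\<dots> = \<one>\<^bsub>K\<^esub>"
  proof (cases "n = 0")
    case True
    then show ?thesis
      by (simp add: monomial_def) (simp add: group_algebra_def)
  next
    case False
    then have "g [^]\<^bsub>G\<^esub> n \<noteq> \<one>\<^bsub>G\<^esub>" using Suc.prems by simp
    then have "\<iota> (g [^]\<^bsub>G\<^esub> n) \<one>\<^bsub>G\<^esub> = \<zero>\<^bsub>K\<^esub>" using g by (auto simp: monomial_def)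
    then show ?thesis using False Suc by simp
  qed
  finally show ?case .
qed simp

lemma finite_translate_fibre:
  assumes b: "b \<in> carrier A" "b \<noteq> \<zero>\<^bsub>A\<^esub>"
  shows "finite {h \<in> carrier G. \<iota> h \<otimes>\<^bsub>A\<^esub> b = v}"
proof (cases "v \<in> carrier A \<and> v \<noteq> \<zero>\<^bsub>A\<^esub>")
  case True
  have "{h \<in> carrier G. \<iota> h \<otimes>\<^bsub>A\<^esub> b = v} = {h \<in> carrier G. \<one>\<^bsub>A\<^esub> \<otimes>\<^bsub>A\<^esub> (\<iota> h \<otimes>\<^bsub>A\<^esub> b) = v}"
    using b by auto
  then show ?thesis using finite_sandwich_fibre[OF A.one_closed b(1), of v] True by simp
next
  case False
  \<comment> \<open>A unit times a nonzero element is nonzero, so for such \<open>v\<close> the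
    fibre is empty.\<close>
  have "\<iota> h \<otimes>\<^bsub>A\<^esub> b \<in> carrier A" "\<iota> h \<otimes>\<^bsub>A\<^esub> b \<noteq> \<zero>\<^bsub>A\<^esub>" if h: "h \<in> carrier G" for h
  proof -
    have u: "\<iota> h \<in> Units A" using h monomial_unit by simp
    show "\<iota> h \<otimes>\<^bsub>A\<^esub> b \<in> carrier A" using h b by simp
    show "\<iota> h \<otimes>\<^bsub>A\<^esub> b \<noteq> \<zero>\<^bsub>A\<^esub>"
      using A.Units_l_cancel[OF u b(1) A.zero_closed] b h by simp
  qed
  then have "{h \<in> carrier G. \<iota> h \<otimes>\<^bsub>A\<^esub> b = v} = {}" using False by blast
  then show ?thesis by (metis finite.emptyI)
qed

section \<open>Group algebras with a hyperbolic group of units\<close>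

context
  fixes p :: nat
  assumes hyp: "hyperbolic_group (units_of A)" and p: "p > 0" "add_pow K p \<one>\<^bsub>K\<^esub> = \<zero>\<^bsub>K\<^esub>"
begin

lemma finite_null_subset:
  assumes "V \<subseteq> carrier A" "\<And>v w. \<lbrakk>v \<in> V; w \<in> V\<rbrakk> \<Longrightarrow> v \<otimes>\<^bsub>A\<^esub> w = \<zero>\<^bsub>A\<^esub>"
  shows "finite V"
  using A.finite_null_set[OF hyp p(1) _ assms] p(2) by (simp add: add_pow_one scalar_zero)

text \<open>In a product \<open>(a h b) (a k b)\<close> the factor \<open>b a\<close> appears, so
  the elements \<open>a h b\<close> form a set with vanishing products and take finitely many
  values. Each nonzero value has a finite fibre.\<close>

lemma finite_sandwich_nonzero:
  assumes a: "a \<in> carrier A" and b: "b \<in> carrier A" and ba: "b \<otimes>\<^bsub>A\<^esub> a = \<zero>\<^bsub>A\<^esub>"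
  shows "finite {h \<in> carrier G. a \<otimes>\<^bsub>A\<^esub> (\<iota> h \<otimes>\<^bsub>A\<^esub> b) \<noteq> \<zero>\<^bsub>A\<^esub>}"
proof -
  define V where "V = (\<lambda>h. a \<otimes>\<^bsub>A\<^esub> (\<iota> h \<otimes>\<^bsub>A\<^esub> b)) ` carrier G"
  have Vc: "V \<subseteq> carrier A" using a b by (auto simp: V_def)
  have "finite V"
  proof (rule finite_null_subset[OF Vc])
    fix v w assume "v \<in> V" "w \<in> V"
    then obtain h k where h: "h \<in> carrier G" "v = a \<otimes>\<^bsub>A\<^esub> (\<iota> h \<otimes>\<^bsub>A\<^esub> b)"
      and k: "k \<in> carrier G" "w = a \<otimes>\<^bsub>A\<^esub> (\<iota> k \<otimes>\<^bsub>A\<^esub> b)" by (auto simp: V_def)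
    have "v \<otimes>\<^bsub>A\<^esub> w = a \<otimes>\<^bsub>A\<^esub> (\<iota> h \<otimes>\<^bsub>A\<^esub> ((b \<otimes>\<^bsub>A\<^esub> a) \<otimes>\<^bsub>A\<^esub> (\<iota> k \<otimes>\<^bsub>A\<^esub> b)))"
      using h k a b by (simp add: A.m_assoc)
    then show "v \<otimes>\<^bsub>A\<^esub> w = \<zero>\<^bsub>A\<^esub>" using h k a b ba by simp
  qed
  then have "finite (\<Union>v\<in>V - {\<zero>\<^bsub>A\<^esub>}. {h \<in> carrier G. a \<otimes>\<^bsub>A\<^esub> (\<iota> h \<otimes>\<^bsub>A\<^esub> b) = v})"
    using Vc finite_sandwich_fibre[OF a b] by (intro finite_UN_I) auto
  then show ?thesis by (rule finite_subset[rotated]) (auto simp: V_def)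
qed

lemma finite_of_torsion:
  assumes tor: "torsion_part G \<noteq> {\<one>\<^bsub>G\<^esub>}"
  shows "finite (carrier K) \<and> finite (carrier G)"
proof -
  have "\<one>\<^bsub>G\<^esub> \<in> torsion_part G" by (auto simp: torsion_part_def intro!: exI[of _ 1])
  then obtain g where g: "g \<in> carrier G" "g \<noteq> \<one>\<^bsub>G\<^esub>" "\<exists>n::nat. n > 0 \<and> g [^]\<^bsub>G\<^esub> n = \<one>\<^bsub>G\<^esub>"
    using tor by (auto simp: torsion_part_def)
  define n where "n = (LEAST n::nat. n > 0 \<and> g [^]\<^bsub>G\<^esub> n = \<one>\<^bsub>G\<^esub>)"
  have n: "n > 0" "g [^]\<^bsub>G\<^esub> n = \<one>\<^bsub>G\<^esub>" using LeastI_ex[OF g(3)] by (auto simp: n_def)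
  have least: "g [^]\<^bsub>G\<^esub> i \<noteq> \<one>\<^bsub>G\<^esub>" if "0 < i" "i < n" for i
    using not_less_Least[of i "\<lambda>n. n > 0 \<and> g [^]\<^bsub>G\<^esub> n = \<one>\<^bsub>G\<^esub>"] that by (auto simp: n_def)
  define \<gamma> where "\<gamma> = \<iota> g"
  define s where "s = (\<Oplus>\<^bsub>A\<^esub>i\<in>{..<n}. \<gamma> [^]\<^bsub>A\<^esub> i)"
  have \<gamma>: "\<gamma> \<in> carrier A" "\<gamma> [^]\<^bsub>A\<^esub> n = \<one>\<^bsub>A\<^esub>"
    using g(1) n by (simp_all add: \<gamma>_def monomial_pow monomial_one)
  have s: "s \<in> carrier A" "\<gamma> \<otimes>\<^bsub>A\<^esub> s = s" "s \<otimes>\<^bsub>A\<^esub> \<gamma> = s"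
    using A.power_sum_closed[OF \<gamma>(1)] A.power_sum_fixed[OF \<gamma>] by (simp_all add: s_def)
  have "s \<one>\<^bsub>G\<^esub> = \<one>\<^bsub>K\<^esub>"
    using power_sum_at_one[OF g(1) n(1) least] by (simp add: s_def \<gamma>_def)
  then have s0: "s \<noteq> \<zero>\<^bsub>A\<^esub>" by (auto simp: group_algebra_def)
  \<comment> \<open>Being fixed by \<open>\<gamma>\<close> becomes being annihilated by
    \<open>t\<close>, the form that \<open>finite_sandwich_nonzero\<close> requires.\<close>
  define t where "t = \<one>\<^bsub>A\<^esub> \<ominus>\<^bsub>A\<^esub> \<gamma>"
  have t: "t \<in> carrier A" using \<gamma> by (simp add: t_def)
  have ta: "t \<otimes>\<^bsub>A\<^esub> a = \<zero>\<^bsub>A\<^esub> \<longleftrightarrow> \<gamma> \<otimes>\<^bsub>A\<^esub> a = a" "a \<otimes>\<^bsub>A\<^esub> t = \<zero>\<^bsub>A\<^esub> \<longleftrightarrow> a \<otimes>\<^bsub>A\<^esub> \<gamma> = a"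
    if a: "a \<in> carrier A" for a
  proof -
    have "t \<otimes>\<^bsub>A\<^esub> a = a \<ominus>\<^bsub>A\<^esub> \<gamma> \<otimes>\<^bsub>A\<^esub> a" "a \<otimes>\<^bsub>A\<^esub> t = a \<ominus>\<^bsub>A\<^esub> a \<otimes>\<^bsub>A\<^esub> \<gamma>"
      using a \<gamma> by (simp_all add: t_def A.minus_eq A.l_distr A.r_distr A.l_minus A.r_minus)
    then show "t \<otimes>\<^bsub>A\<^esub> a = \<zero>\<^bsub>A\<^esub> \<longleftrightarrow> \<gamma> \<otimes>\<^bsub>A\<^esub> a = a" "a \<otimes>\<^bsub>A\<^esub> t = \<zero>\<^bsub>A\<^esub> \<longleftrightarrow> a \<otimes>\<^bsub>A\<^esub> \<gamma> = a"
      using a \<gamma> by (auto simp: A.r_right_minus_eq)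
  qed
  show ?thesis
  proof (cases "add_pow K n \<one>\<^bsub>K\<^esub> = \<zero>\<^bsub>K\<^esub>")
    case True
    \<comment> \<open>Here \<open>s\<close> acts on elements fixed by \<open>\<gamma>\<close> as the
      integer \<open>n\<close>, which is zero in \<open>K\<close>.\<close>
    have kill: "s \<otimes>\<^bsub>A\<^esub> a = \<zero>\<^bsub>A\<^esub>" if "a \<in> carrier A" "\<gamma> \<otimes>\<^bsub>A\<^esub> a = a" for a
      using A.power_sum_absorb(1)[OF \<gamma>(1) that(1,2), of n] that(1) True
      by (simp add: add_pow_eq_scalar scalar_zero s_def)
    have "finite ((\<lambda>k. mono_el k \<one>\<^bsub>G\<^esub> \<otimes>\<^bsub>A\<^esub> s) ` carrier K)"
    proof (rule finite_null_subset, safe)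
      fix k l assume kl: "k \<in> carrier K" "l \<in> carrier K"
      have "(mono_el k \<one>\<^bsub>G\<^esub> \<otimes>\<^bsub>A\<^esub> s) \<otimes>\<^bsub>A\<^esub> (mono_el l \<one>\<^bsub>G\<^esub> \<otimes>\<^bsub>A\<^esub> s)
          = mono_el k \<one>\<^bsub>G\<^esub> \<otimes>\<^bsub>A\<^esub> ((s \<otimes>\<^bsub>A\<^esub> s) \<otimes>\<^bsub>A\<^esub> mono_el l \<one>\<^bsub>G\<^esub>)"
        using kl s by (simp add: scalar_commutes[of l s] A.m_assoc)
      then show "(mono_el k \<one>\<^bsub>G\<^esub> \<otimes>\<^bsub>A\<^esub> s) \<otimes>\<^bsub>A\<^esub> (mono_el l \<one>\<^bsub>G\<^esub> \<otimes>\<^bsub>A\<^esub> s) = \<zero>\<^bsub>A\<^esub>"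
        using kl kill[OF s(1,2)] by simp
    qed (use s in simp)
    then have K: "finite (carrier K)"
      using scalar_mult_inj[OF s(1) s0] finite_imageD by blast
    \<comment> \<open>For \<open>k\<close> in \<open>?N\<close> the element \<open>k s\<close> is
      fixed by \<open>\<gamma>\<close>, hence \<open>s (k s) = 0\<close> and the elements
      \<open>h s\<close> with \<open>h\<close> in \<open>?N\<close> have vanishing products.\<close>
    let ?N = "{h \<in> carrier G. t \<otimes>\<^bsub>A\<^esub> (\<iota> h \<otimes>\<^bsub>A\<^esub> s) = \<zero>\<^bsub>A\<^esub>}"
    have "finite ((\<lambda>h. \<iota> h \<otimes>\<^bsub>A\<^esub> s) ` ?N)"
    proof (rule finite_null_subset, safe)
      fix h k assume h: "h \<in> carrier G" and k: "k \<in> carrier G" "t \<otimes>\<^bsub>A\<^esub> (\<iota> k \<otimes>\<^bsub>A\<^esub> s) = \<zero>\<^bsub>A\<^esub>"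
      have "(\<iota> h \<otimes>\<^bsub>A\<^esub> s) \<otimes>\<^bsub>A\<^esub> (\<iota> k \<otimes>\<^bsub>A\<^esub> s) = \<iota> h \<otimes>\<^bsub>A\<^esub> (s \<otimes>\<^bsub>A\<^esub> (\<iota> k \<otimes>\<^bsub>A\<^esub> s))"
        using h k s by (simp add: A.m_assoc)
      then show "(\<iota> h \<otimes>\<^bsub>A\<^esub> s) \<otimes>\<^bsub>A\<^esub> (\<iota> k \<otimes>\<^bsub>A\<^esub> s) = \<zero>\<^bsub>A\<^esub>"
        using h k s ta(1) kill by simp
    qed (use s in simp)
    then have "finite ?N"
      by (rule finite_of_finite_fibres)
        (use finite_translate_fibre[OF s(1) s0] in \<open>auto intro: rev_finite_subset\<close>)
    moreover have "finite {h \<in> carrier G. t \<otimes>\<^bsub>A\<^esub> (\<iota> h \<otimes>\<^bsub>A\<^esub> s) \<noteq> \<zero>\<^bsub>A\<^esub>}"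
      using finite_sandwich_nonzero[OF t s(1)] ta(2)[OF s(1)] s by simp
    ultimately have "finite (?N \<union> {h \<in> carrier G. t \<otimes>\<^bsub>A\<^esub> (\<iota> h \<otimes>\<^bsub>A\<^esub> s) \<noteq> \<zero>\<^bsub>A\<^esub>})" by simp
    then have "finite (carrier G)" by (rule finite_subset[rotated]) auto
    with K show ?thesis ..
  next
    case False
    \<comment> \<open>\<open>c\<close> is the inverse of \<open>n\<close> in \<open>K\<close>, so
      that \<open>e = c s\<close> acts as the identity on the elements fixed by
      \<open>\<gamma>\<close>, on the left by \<open>ea\<close> and on the right by
      \<open>ae\<close>.\<close>
    define c where "c = inv\<^bsub>K\<^esub> (add_pow K n \<one>\<^bsub>K\<^esub>)"
    have c: "c \<in> carrier K" "c \<otimes>\<^bsub>K\<^esub> add_pow K n \<one>\<^bsub>K\<^esub> = \<one>\<^bsub>K\<^esub>"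
      using False K.field_Units by (auto simp: c_def)
    then have c0: "c \<noteq> \<zero>\<^bsub>K\<^esub>" by auto
    define e where "e = mono_el c \<one>\<^bsub>G\<^esub> \<otimes>\<^bsub>A\<^esub> s"
    define f where "f = \<one>\<^bsub>A\<^esub> \<ominus>\<^bsub>A\<^esub> e"
    have sc: "mono_el c \<one>\<^bsub>G\<^esub> \<in> carrier A" using c by simp
    have e: "e \<in> carrier A" using sc s by (simp add: e_def)
    have \<gamma>e: "\<gamma> \<otimes>\<^bsub>A\<^esub> e = e"
    proof -
      have "\<gamma> \<otimes>\<^bsub>A\<^esub> e = mono_el c \<one>\<^bsub>G\<^esub> \<otimes>\<^bsub>A\<^esub> (\<gamma> \<otimes>\<^bsub>A\<^esub> s)"
        unfolding e_def using sc s(1) \<gamma>(1) by (simp add: A.m_assoc[symmetric] scalar_commutes[OF c(1) \<gamma>(1)])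
      then show ?thesis by (simp add: s e_def)
    qed
    have e\<gamma>: "e \<otimes>\<^bsub>A\<^esub> \<gamma> = e" using sc s \<gamma> unfolding e_def by (simp add: A.m_assoc)
    have scn: "mono_el c \<one>\<^bsub>G\<^esub> \<otimes>\<^bsub>A\<^esub> add_pow A n a = a" if a: "a \<in> carrier A" for a
    proof -
      have "mono_el c \<one>\<^bsub>G\<^esub> \<otimes>\<^bsub>A\<^esub> add_pow A n a
          = (mono_el c \<one>\<^bsub>G\<^esub> \<otimes>\<^bsub>A\<^esub> mono_el (add_pow K n \<one>\<^bsub>K\<^esub>) \<one>\<^bsub>G\<^esub>) \<otimes>\<^bsub>A\<^esub> a"
        using a c by (simp add: add_pow_eq_scalar A.m_assoc)
      then show ?thesis using a c by (simp add: monomial_mult monomial_one)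
    qed
    have ea: "e \<otimes>\<^bsub>A\<^esub> a = a" if "a \<in> carrier A" "\<gamma> \<otimes>\<^bsub>A\<^esub> a = a" for a
      using A.power_sum_absorb(1)[OF \<gamma>(1) that, of n] scn[OF that(1)] that sc s
      by (simp add: e_def A.m_assoc s_def)
    have ae: "a \<otimes>\<^bsub>A\<^esub> e = a" if "a \<in> carrier A" "a \<otimes>\<^bsub>A\<^esub> \<gamma> = a" for a
    proof -
      have "a \<otimes>\<^bsub>A\<^esub> e = mono_el c \<one>\<^bsub>G\<^esub> \<otimes>\<^bsub>A\<^esub> (a \<otimes>\<^bsub>A\<^esub> s)"
        unfolding e_def using that sc s scalar_commutes[OF c(1) that(1)] by (simp add: A.m_assoc[symmetric])
      then show ?thesis
        using A.power_sum_absorb(2)[OF \<gamma>(1) that, of n] scn[OF that(1)] by (simp add: s_def)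
    qed
    have ee: "e \<otimes>\<^bsub>A\<^esub> e = e" using ea[OF e \<gamma>e] .
    have f: "f \<in> carrier A" using e by (simp add: f_def)
    have sum: "e \<oplus>\<^bsub>A\<^esub> f = \<one>\<^bsub>A\<^esub>"
      using A.a_comm[OF e f] e by (simp add: f_def A.minus_eq A.a_assoc A.l_neg)
    have ef: "e \<otimes>\<^bsub>A\<^esub> f = \<zero>\<^bsub>A\<^esub>" "f \<otimes>\<^bsub>A\<^esub> e = \<zero>\<^bsub>A\<^esub>"
      using e ee by (simp_all add: f_def A.minus_eq A.l_distr A.r_distr A.l_minus A.r_minus A.r_neg)
    have e0: "e \<noteq> \<zero>\<^bsub>A\<^esub>"
    proof
      assume "e = \<zero>\<^bsub>A\<^esub>"
      then have "mono_el c \<one>\<^bsub>G\<^esub> \<otimes>\<^bsub>A\<^esub> s = mono_el \<zero>\<^bsub>K\<^esub> \<one>\<^bsub>G\<^esub> \<otimes>\<^bsub>A\<^esub> s"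
        using s by (simp add: e_def scalar_zero)
      then show False
        using inj_onD[OF scalar_mult_inj[OF s(1) s0]] c c0 by blast
    qed
    \<comment> \<open>\<open>f = 0\<close> means \<open>e = 1\<close>, and then
      \<open>\<gamma> e = e\<close> would make \<open>g\<close> trivial.\<close>
    have f0: "f \<noteq> \<zero>\<^bsub>A\<^esub>"
    proof
      assume "f = \<zero>\<^bsub>A\<^esub>"
      then have "e = \<one>\<^bsub>A\<^esub>" using sum e by simp
      then have "\<iota> g = \<iota> \<one>\<^bsub>G\<^esub>" using \<gamma>e \<gamma> by (simp add: \<gamma>_def monomial_one)
      then show False using inj_onD[OF monomial_inj] g by blast
    qed
    \<comment> \<open>The nonzero scalars are central units, and multiplying them by the nonzero
      element \<open>e\<close> or \<open>f\<close> is injective.\<close>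
    have "finite ((\<lambda>k. mono_el k \<one>\<^bsub>G\<^esub>) ` (carrier K - {\<zero>\<^bsub>K\<^esub>}))" (is "finite ?W")
    proof (rule A.finite_units_commuting_with_idempotent[OF hyp e f sum ef])
      show "?W \<subseteq> Units A" by (auto intro: monomial_unit)
      show "\<one>\<^bsub>A\<^esub> \<in> ?W"
        by (rule image_eqI[where x = "\<one>\<^bsub>K\<^esub>"]) (simp_all add: monomial_one)
      show "v \<otimes>\<^bsub>A\<^esub> w \<in> ?W" if "v \<in> ?W" "w \<in> ?W" for v w
        using that by (auto simp: monomial_mult K.integral_iff)
      show "w \<otimes>\<^bsub>A\<^esub> e = e \<otimes>\<^bsub>A\<^esub> w" if "w \<in> ?W" for w using that e by (auto intro: scalar_commutes)
      have "finite {w \<in> ?W. w \<otimes>\<^bsub>A\<^esub> a = b}" if a: "a \<in> carrier A" "a \<noteq> \<zero>\<^bsub>A\<^esub>" for a b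
      proof -
        have "inj_on (\<lambda>w. w \<otimes>\<^bsub>A\<^esub> a) ?W"
          using scalar_mult_inj[OF a] by (auto simp: inj_on_def)
        then have "finite {w \<in> ?W. w \<otimes>\<^bsub>A\<^esub> a \<in> {b}}" by (rule finite_inverse_image_gen[rotated]) simp
        then show ?thesis by simp
      qed
      then show "finite {w \<in> ?W. w \<otimes>\<^bsub>A\<^esub> e = b}" "finite {w \<in> ?W. w \<otimes>\<^bsub>A\<^esub> f = b}" for b
        using e e0 f f0 by blast+
    qed
    moreover have "inj_on (\<lambda>k. mono_el k \<one>\<^bsub>G\<^esub>) (carrier K - {\<zero>\<^bsub>K\<^esub>})"
      by (rule inj_onI, rule inj_onD[OF scalar_mult_inj[OF e e0]]) auto
    ultimately have "finite (carrier K - {\<zero>\<^bsub>K\<^esub>})" by (rule finite_imageD)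
    then have K: "finite (carrier K)" by simp
    \<comment> \<open>The centraliser of \<open>e\<close> in \<open>G\<close>. Multiplication of its
      elements by \<open>e\<close> or \<open>f\<close> has finite fibres by
      \<open>finite_translate_fibre\<close>.\<close>
    let ?C = "{h \<in> carrier G. \<iota> h \<otimes>\<^bsub>A\<^esub> e = e \<otimes>\<^bsub>A\<^esub> \<iota> h}"
    have "finite (\<iota> ` ?C)"
    proof (rule A.finite_units_commuting_with_idempotent[OF hyp e f sum ef])
      show "\<iota> ` ?C \<subseteq> Units A" by (auto intro: monomial_unit)
      show "\<one>\<^bsub>A\<^esub> \<in> \<iota> ` ?C" 
        using e by (intro image_eqI[where x = "\<one>\<^bsub>G\<^esub>"]) (simp_all add: monomial_one)
      show "v \<otimes>\<^bsub>A\<^esub> w \<in> \<iota> ` ?C" if v: "v \<in> \<iota> ` ?C" and w: "w \<in> \<iota> ` ?C" for v w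
      proof -
        obtain h where h: "h \<in> carrier G" "v = \<iota> h" "v \<otimes>\<^bsub>A\<^esub> e = e \<otimes>\<^bsub>A\<^esub> v"
          using v by auto
        obtain k where k: "k \<in> carrier G" "w = \<iota> k" "w \<otimes>\<^bsub>A\<^esub> e = e \<otimes>\<^bsub>A\<^esub> w" using w by auto
        have vw: "v \<in> carrier A" "w \<in> carrier A" using h k by auto
        have "(v \<otimes>\<^bsub>A\<^esub> w) \<otimes>\<^bsub>A\<^esub> e = (v \<otimes>\<^bsub>A\<^esub> e) \<otimes>\<^bsub>A\<^esub> w" using vw e k by (simp add: A.m_assoc)
        also have "\<dots> = e \<otimes>\<^bsub>A\<^esub> (v \<otimes>\<^bsub>A\<^esub> w)" unfolding h(3) using vw e by (simp add: A.m_assoc)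
        finally have "(v \<otimes>\<^bsub>A\<^esub> w) \<otimes>\<^bsub>A\<^esub> e = e \<otimes>\<^bsub>A\<^esub> (v \<otimes>\<^bsub>A\<^esub> w)" .
        moreover have "v \<otimes>\<^bsub>A\<^esub> w = \<iota> (h \<otimes>\<^bsub>G\<^esub> k)" using h k by (simp add: monomial_mult)
        ultimately show ?thesis using h k by auto
      qed
      show "w \<otimes>\<^bsub>A\<^esub> e = e \<otimes>\<^bsub>A\<^esub> w" if "w \<in> \<iota> ` ?C" for w using that by auto
      have "finite {w \<in> \<iota> ` ?C. w \<otimes>\<^bsub>A\<^esub> a = b}" if a: "a \<in> carrier A" "a \<noteq> \<zero>\<^bsub>A\<^esub>" for a b
        by (rule finite_subset[OF _ finite_imageI[OF finite_translate_fibre[OF a, of b], of \<iota>]]) auto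
      then show "finite {w \<in> \<iota> ` ?C. w \<otimes>\<^bsub>A\<^esub> e = b}" "finite {w \<in> \<iota> ` ?C. w \<otimes>\<^bsub>A\<^esub> f = b}" for b
        using e e0 f f0 by blast+
    qed
    moreover have "inj_on \<iota> ?C" using monomial_inj by (rule inj_on_subset) auto
    ultimately have C: "finite ?C" by (rule finite_imageD)
    \<comment> \<open>The first equation says that \<open>h e\<close> is fixed by
      \<open>\<gamma>\<close> on the left, so \<open>e h e = h e\<close>; the second says that
      \<open>e h\<close> is fixed on the right, so \<open>e h e = e h\<close>.\<close>
    have "h \<in> ?C" if h: "h \<in> carrier G" "t \<otimes>\<^bsub>A\<^esub> (\<iota> h \<otimes>\<^bsub>A\<^esub> e) = \<zero>\<^bsub>A\<^esub>" "e \<otimes>\<^bsub>A\<^esub> (\<iota> h \<otimes>\<^bsub>A\<^esub> t) = \<zero>\<^bsub>A\<^esub>" for h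
    proof -
      have h': "\<iota> h \<in> carrier A" using h by simp
      have "e \<otimes>\<^bsub>A\<^esub> (\<iota> h \<otimes>\<^bsub>A\<^esub> e) = \<iota> h \<otimes>\<^bsub>A\<^esub> e" using h h' e ta(1) by (intro ea) auto
      moreover have "(e \<otimes>\<^bsub>A\<^esub> \<iota> h) \<otimes>\<^bsub>A\<^esub> e = e \<otimes>\<^bsub>A\<^esub> \<iota> h"
        using h h' e t ta(2)[of "e \<otimes>\<^bsub>A\<^esub> \<iota> h"] by (intro ae) (auto simp: A.m_assoc)
      ultimately show ?thesis using h h' e by (simp add: A.m_assoc)
    qed
    then have "carrier G \<subseteq> ?C \<union> {h \<in> carrier G. t \<otimes>\<^bsub>A\<^esub> (\<iota> h \<otimes>\<^bsub>A\<^esub> e) \<noteq> \<zero>\<^bsub>A\<^esub>}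
        \<union> {h \<in> carrier G. e \<otimes>\<^bsub>A\<^esub> (\<iota> h \<otimes>\<^bsub>A\<^esub> t) \<noteq> \<zero>\<^bsub>A\<^esub>}" by blast
    \<comment> \<open>Both exceptional sets are finite since \<open>e t = 0\<close> and
      \<open>t e = 0\<close>.\<close>
    moreover have "finite \<dots>"
      using C finite_sandwich_nonzero[OF t e] finite_sandwich_nonzero[OF e t] ta[OF e] \<gamma>e e\<gamma> by simp
    ultimately have "finite (carrier G)" by (rule finite_subset)
    with K show ?thesis ..
  qed
qed

end

lemma finite_group_algebra:
  assumes "finite (carrier K)" "finite (carrier G)"
  shows "finite (carrier A)"
proof (rule finite_subset)
  show "carrier A \<subseteq> carrier G \<rightarrow>\<^sub>E carrier K" by (auto simp: group_algebra_def)
qed (use assms in \<open>auto intro: finite_PiE\<close>)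

end

lemma ring_characteristic_pos:
  assumes "ring_characteristic R > 0"
  shows "add_pow R (ring_characteristic R) \<one>\<^bsub>R\<^esub> = \<zero>\<^bsub>R\<^esub>"
proof -
  have ex: "\<exists>n::nat. n > 0 \<and> add_pow R n \<one>\<^bsub>R\<^esub> = \<zero>\<^bsub>R\<^esub>"
    using assms unfolding ring_characteristic_def by (auto split: if_splits)
  show ?thesis using LeastI_ex[OF ex] ex unfolding ring_characteristic_def by simp
qed

theorem theorem2:
  fixes K :: "('k, 'm) ring_scheme" and G :: "('g, 'n) monoid_scheme"
  assumes "field K"
    and "ring_characteristic K > 0"
    and "group G"
    and "torsion_part G \<noteq> {\<one>\<^bsub>G\<^esub>}"
  shows "hyperbolic_group (units_of (group_algebra K G)) \<longleftrightarrow>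
    finite (carrier K) \<and> finite (carrier G)"
proof -
  interpret group_algebra_over_field K G
    using assms by (simp add: group_algebra_over_field_def)
  show ?thesis
  proof
    assume "hyperbolic_group (units_of A)"
    then show "finite (carrier K) \<and> finite (carrier G)"
      using finite_of_torsion assms(2,4) ring_characteristic_pos by blast
  next
    assume "finite (carrier K) \<and> finite (carrier G)"
    then have "finite (Units A)"
      using finite_group_algebra finite_subset[of "Units A" "carrier A"] by auto
    then show "hyperbolic_group (units_of A)"
      by (intro finite_imp_hyperbolic_group A.units_group) (simp add: units_of_carrier)
  qed
qed

end
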